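(* Let $\kappa>0$, $M>0$, $\delta>0$, $C\in\mathbb{R}\setminus\{0\}$ and $\beta\in(-1,1)$ with $\beta^2\neq\tfrac12$. Set $$\xi_0=\sqrt{\frac{1-\beta^2}{2\kappa}},\qquad \xi_1=-\xi_3=\frac{\beta}{\xi_0},\qquad \xi_2=\frac{2\xi_0^2\kappa}{\beta^2-2\xi_0^2\kappa},\qquad V_0=-\frac{2\xi_0^2C^2(\beta^2-6\xi_0^2\kappa)}{(2\xi_0^2\kappa-\beta^2)^2},$$ $$f(r)=1-\frac{2M}{r},\qquad g(r,\theta)=1-\frac{2M}{r}+\frac{M^2\sin^2\theta}{r^2},\qquad a(t)=(Ct)^{\xi_2}.$$ Then, for $2M<r<\infty$, $(\theta,\varphi)$ spherical angles, and $0<t<\infty$ if $C>0$ (respectively $-\infty<t<0$ if $C<0$), the metric and scalar field $$d\tilde s^2=a^2(t)\left\{-f^{\delta\beta}dt^2+f^{-\delta\beta}\left[\left(\frac{f}{g}\right)^{\delta^2}g\left(\frac{dr^2}{f}+r^2d\theta^2\right)+f\,r^2\sin^2\theta\,d\varphi^2\right]\right\},$$ $$\tilde\phi=\delta\,\xi_0\ln\left(1-\frac{2M}{r}\right)+\frac{\xi_1\xi_2}{\kappa}\ln(Ct)$$ form an exact solution of the Einstein–scalar system with self-interacting potential $V(\tilde\phi)=V_0e^{\xi_3\tilde\phi}$.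
   Context: The Einstein–scalar system with self-interacting potential $V$, for a four-dimensional Lorentzian metric $\tilde g$ of signature $(-,+,+,+)$ and a real scalar field $\tilde\phi$, is $$\tilde G_{\mu\nu}=\kappa\left[\partial_\mu\tilde\phi\,\partial_\nu\tilde\phi-\tilde g_{\mu\nu}\left(\tfrac12\tilde g^{\alpha\beta}\partial_\alpha\tilde\phi\,\partial_\beta\tilde\phi+V(\tilde\phi)\right)\right],\qquad \tilde\Box\tilde\phi=\frac{dV}{d\tilde\phi}(\tilde\phi),$$ where $\tilde G_{\mu\nu}$ is the Einstein tensor of $\tilde g$, $\tilde\Box=\tilde g^{\mu\nu}\tilde\nabla_\mu\tilde\nabla_\nu$, and $\kappa=8\pi G>0$. *)

theory Defs
  imports "HOL-Analysis.Analysis"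
begin

text \<open>
  Points of a coordinate chart are vectors of type \<open>real ^ 4\<close>; the coordinates are
  \<open>x $ 0\<close> (time), \<open>x $ 1\<close>, \<open>x $ 2\<close>, \<open>x $ 3\<close>. (In the type \<open>4\<close> the numeral \<open>4\<close> equals \<open>0\<close>.)
  A metric is its matrix of coordinate components, as a function of the point.
\<close>

definition partial :: "4 \<Rightarrow> (real ^ 4 \<Rightarrow> real) \<Rightarrow> real ^ 4 \<Rightarrow> real" where
  "partial \<mu> u x = deriv (\<lambda>h. u (x + h *\<^sub>R axis \<mu> 1)) 0"

text \<open>On an open set this is the usual notion of class \<open>C\<^sup>k\<close>.\<close>

primrec Ck_on :: "nat \<Rightarrow> (real ^ 4) set \<Rightarrow> (real ^ 4 \<Rightarrow> real) \<Rightarrow> bool" where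
  "Ck_on 0 U u \<longleftrightarrow> continuous_on U u"
| "Ck_on (Suc k) U u \<longleftrightarrow>
     (\<forall>x\<in>U. u differentiable (at x)) \<and> (\<forall>\<mu>. Ck_on k U (partial \<mu> u))"

definition smooth_on :: "(real ^ 4) set \<Rightarrow> (real ^ 4 \<Rightarrow> real) \<Rightarrow> bool" where
  "smooth_on U u \<longleftrightarrow> (\<forall>k. Ck_on k U u)"

definition diag4 :: "real \<Rightarrow> real \<Rightarrow> real \<Rightarrow> real \<Rightarrow> real ^ 4 ^ 4" where
  "diag4 a b c d = (\<chi> \<mu> \<nu>. if \<mu> \<noteq> \<nu> then 0
     else if \<mu> = 0 then a else if \<mu> = 1 then b else if \<mu> = 2 then c else d)"

text \<open>Signature \<open>(-,+,+,+)\<close> at each point, expressed by an orthonormal frame (the columns of \<open>P\<close>).\<close>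

definition lorentzian_metric_on :: "(real ^ 4) set \<Rightarrow> (real ^ 4 \<Rightarrow> real ^ 4 ^ 4) \<Rightarrow> bool" where
  "lorentzian_metric_on U g \<longleftrightarrow>
     (\<forall>\<mu> \<nu>. smooth_on U (\<lambda>x. g x $ \<mu> $ \<nu>)) \<and>
     (\<forall>x\<in>U. transpose (g x) = g x \<and>
        (\<exists>P. invertible P \<and> transpose P ** g x ** P = diag4 (-1) 1 1 1))"

definition inv_metric :: "(real ^ 4 \<Rightarrow> real ^ 4 ^ 4) \<Rightarrow> 4 \<Rightarrow> 4 \<Rightarrow> real ^ 4 \<Rightarrow> real" where
  "inv_metric g \<mu> \<nu> x = matrix_inv (g x) $ \<mu> $ \<nu>"

text \<open>\<open>christoffel g l \<mu> \<nu>\<close> is the symbol with upper index \<open>l\<close> and lower indices \<open>\<mu>\<close>, \<open>\<nu>\<close>.\<close>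

definition christoffel ::
  "(real ^ 4 \<Rightarrow> real ^ 4 ^ 4) \<Rightarrow> 4 \<Rightarrow> 4 \<Rightarrow> 4 \<Rightarrow> real ^ 4 \<Rightarrow> real" where
  "christoffel g l \<mu> \<nu> x = (\<Sum>\<sigma>\<in>UNIV. inv_metric g l \<sigma> x / 2 *
     (partial \<mu> (\<lambda>y. g y $ \<sigma> $ \<nu>) x + partial \<nu> (\<lambda>y. g y $ \<sigma> $ \<mu>) x
      - partial \<sigma> (\<lambda>y. g y $ \<mu> $ \<nu>) x))"

text \<open>Sign convention: round spheres have positive Ricci curvature.\<close>

definition ricci :: "(real ^ 4 \<Rightarrow> real ^ 4 ^ 4) \<Rightarrow> 4 \<Rightarrow> 4 \<Rightarrow> real ^ 4 \<Rightarrow> real" where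
  "ricci g \<mu> \<nu> x =
     (\<Sum>l\<in>UNIV. partial l (christoffel g l \<mu> \<nu>) x - partial \<nu> (christoffel g l l \<mu>) x)
     + (\<Sum>l\<in>UNIV. \<Sum>\<sigma>\<in>UNIV.
          christoffel g l l \<sigma> x * christoffel g \<sigma> \<mu> \<nu> x
          - christoffel g l \<nu> \<sigma> x * christoffel g \<sigma> l \<mu> x)"

definition scalar_curvature :: "(real ^ 4 \<Rightarrow> real ^ 4 ^ 4) \<Rightarrow> real ^ 4 \<Rightarrow> real" where
  "scalar_curvature g x = (\<Sum>\<mu>\<in>UNIV. \<Sum>\<nu>\<in>UNIV. inv_metric g \<mu> \<nu> x * ricci g \<mu> \<nu> x)"

definition einstein_tensor :: "(real ^ 4 \<Rightarrow> real ^ 4 ^ 4) \<Rightarrow> 4 \<Rightarrow> 4 \<Rightarrow> real ^ 4 \<Rightarrow> real" where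
  "einstein_tensor g \<mu> \<nu> x = ricci g \<mu> \<nu> x - scalar_curvature g x / 2 * g x $ \<mu> $ \<nu>"

definition hessian ::
  "(real ^ 4 \<Rightarrow> real ^ 4 ^ 4) \<Rightarrow> (real ^ 4 \<Rightarrow> real) \<Rightarrow> 4 \<Rightarrow> 4 \<Rightarrow> real ^ 4 \<Rightarrow> real" where
  "hessian g \<phi> \<mu> \<nu> x =
     partial \<mu> (partial \<nu> \<phi>) x - (\<Sum>l\<in>UNIV. christoffel g l \<mu> \<nu> x * partial l \<phi> x)"

definition dalembertian :: "(real ^ 4 \<Rightarrow> real ^ 4 ^ 4) \<Rightarrow> (real ^ 4 \<Rightarrow> real) \<Rightarrow> real ^ 4 \<Rightarrow> real" where
  "dalembertian g \<phi> x = (\<Sum>\<mu>\<in>UNIV. \<Sum>\<nu>\<in>UNIV. inv_metric g \<mu> \<nu> x * hessian g \<phi> \<mu> \<nu> x)"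

definition einstein_scalar_solution ::
  "real \<Rightarrow> (real \<Rightarrow> real) \<Rightarrow> (real ^ 4) set \<Rightarrow> (real ^ 4 \<Rightarrow> real ^ 4 ^ 4) \<Rightarrow> (real ^ 4 \<Rightarrow> real) \<Rightarrow> bool"
where
  "einstein_scalar_solution \<kappa> V U g \<phi> \<longleftrightarrow>
     open U \<and> lorentzian_metric_on U g \<and> smooth_on U \<phi> \<and>
     (\<forall>s. V field_differentiable (at s)) \<and>
     (\<forall>x\<in>U.
        (\<forall>\<mu> \<nu>. einstein_tensor g \<mu> \<nu> x =
           \<kappa> * (partial \<mu> \<phi> x * partial \<nu> \<phi> x
                - g x $ \<mu> $ \<nu> *
                  (1/2 * (\<Sum>\<alpha>\<in>UNIV. \<Sum>\<beta>\<in>UNIV.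
                            inv_metric g \<alpha> \<beta> x * partial \<alpha> \<phi> x * partial \<beta> \<phi> x)
                   + V (\<phi> x)))) \<and>
        dalembertian g \<phi> x = deriv V (\<phi> x))"

end

(* The metric is diagonal, g = diag(G_mu), so everything is governed by the logarithmic derivatives
   p_{mu nu} = d_nu (ln |G_mu|) / 2 and their derivatives q_{mu nu sigma}. With
   D = r^2 f = (r - M)^2 - M^2 and Q = r^2 g = D + M^2 sin^2 theta, every ln |G_mu| is a linear
   combination of ln (C t), ln f, ln D, ln Q and ln sin theta, so p and q are rational in r, sin theta
   and cos theta. The field equations are equivalent to the trace-reversed form
   R_{mu nu} = kappa (d_mu phi d_nu phi + g_{mu nu} V).  Time enters only
   through p_{mu 0} = xi_2 / t: it accounts for R_00, R_01 and the g_ij V part of R_ij (V being a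
   multiple of 1 / (t^2 G_0)), and what remains are the static equations, which are rational
   identities in r, sin theta and cos theta. *)

theory Submission
  imports Defs
begin

text \<open>The obstacle is that the components contain real powers of f and g, which no polynomial
  procedure can handle. Logarithms turn the exponents into coefficients, and the powers return only
  through the ratios G_mu / G_l in the curvature. These are harmless for four separate reasons: G_2
  / G_1 is the rational function D; the ratios G_0 / G_l multiply brackets that vanish; G_mu / G_0
  multiplies only time derivatives, which yields the term with V; and in R_33 the static terms share
  the factor G_3 / G_2, which can be treated as a free symbol. Each remaining identity is then a
  consequence of the definitions of D and Q and of cos^2 = 1 - sin^2.\<close>

lemma four_eq_zero: "(4::4) = 0" by simp

lemma exhaust4: "(i::4) = 0 \<or> i = 1 \<or> i = 2 \<or> i = 3"
  using exhaust_4[of i] by auto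

lemma sum4: "sum f (UNIV::4 set) = f 0 + f 1 + f 2 + f 3"
  using sum_4[of f] unfolding four_eq_zero by (simp only: ac_simps)

lemma sum4_Diff:
  fixes h :: "4 \<Rightarrow> real"
  shows
    "sum h (UNIV - {0}) = h 1 + h 2 + h 3"
    "sum h (UNIV - {1}) = h 0 + h 2 + h 3"
    "sum h (UNIV - {2}) = h 0 + h 1 + h 3"
    "sum h (UNIV - {3}) = h 0 + h 1 + h 2"
    "sum h (UNIV - {0, 1}) = h 2 + h 3"
    "sum h (UNIV - {0, 2}) = h 1 + h 3"
    "sum h (UNIV - {0, 3}) = h 1 + h 2"
    "sum h (UNIV - {1, 0}) = h 2 + h 3"
    "sum h (UNIV - {1, 2}) = h 0 + h 3"
    "sum h (UNIV - {1, 3}) = h 0 + h 2"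
    "sum h (UNIV - {2, 0}) = h 1 + h 3"
    "sum h (UNIV - {2, 1}) = h 0 + h 3"
    "sum h (UNIV - {2, 3}) = h 0 + h 1"
    "sum h (UNIV - {3, 0}) = h 1 + h 2"
    "sum h (UNIV - {3, 1}) = h 0 + h 2"
    "sum h (UNIV - {3, 2}) = h 0 + h 1"
  by (simp_all add: sum_diff sum4)

lemma neq4: "(0::4) \<noteq> 1" "(0::4) \<noteq> 2" "(0::4) \<noteq> 3" "(1::4) \<noteq> 2" "(1::4) \<noteq> 3" "(2::4) \<noteq> 3"
  by simp_all

subsection \<open>Partial derivatives and smoothness\<close>

text \<open>\<open>partial\<close> rests on the total function \<open>deriv\<close>, so an equation
  for it does not assert differentiability. Bundling existence with the value gives rules that
  compose.\<close>

definition has_partial :: "4 \<Rightarrow> (real ^ 4 \<Rightarrow> real) \<Rightarrow> real \<Rightarrow> real ^ 4 \<Rightarrow> bool" where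
  "has_partial \<mu> u D x \<longleftrightarrow> ((\<lambda>h. u (x + h *\<^sub>R axis \<mu> 1)) has_real_derivative D) (at 0)"

lemma partial_eq: "has_partial \<mu> u D x \<Longrightarrow> partial \<mu> u x = D"
  unfolding has_partial_def partial_def by (rule DERIV_imp_deriv)

lemma has_partial_cong:
  assumes "open U" "x \<in> U" "\<And>y. y \<in> U \<Longrightarrow> u y = v y"
  shows "has_partial \<mu> u D x \<longleftrightarrow> has_partial \<mu> v D x"
proof -
  have "open ((\<lambda>h::real. x + h *\<^sub>R axis \<mu> 1) -` U)"
    using assms(1) by (intro open_vimage continuous_intros)
  moreover have "0 \<in> (\<lambda>h::real. x + h *\<^sub>R axis \<mu> 1) -` U"
    using assms(2) by simp
  ultimately have "\<forall>\<^sub>F h in nhds 0. x + (h::real) *\<^sub>R axis \<mu> 1 \<in> U"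
    unfolding eventually_nhds by auto
  then have "\<forall>\<^sub>F h in nhds 0. u (x + (h::real) *\<^sub>R axis \<mu> 1) = v (x + h *\<^sub>R axis \<mu> 1)"
    by eventually_elim (use assms in auto)
  then show ?thesis
    unfolding has_partial_def by (intro DERIV_cong_ev) auto
qed

lemma partial_cong:
  assumes "open U" "x \<in> U" "\<And>y. y \<in> U \<Longrightarrow> u y = v y"
  shows "partial \<mu> u x = partial \<mu> v x"
  \<comment> \<open>The equivalence holds for every candidate derivative, so the choice inside
    \<open>deriv\<close> selects the same value on both sides, even where no derivative
    exists.\<close>
  using has_partial_cong[of U x u v, OF assms]
  unfolding has_partial_def partial_def deriv_def by presburger

lemma has_partial_const: "has_partial \<mu> (\<lambda>x. c) 0 x"
  unfolding has_partial_def by simp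

lemma has_partial_coord: "has_partial \<mu> (\<lambda>x. x $ i) (if i = \<mu> then 1 else 0) x"
  unfolding has_partial_def by (auto simp: axis_def intro!: derivative_eq_intros)

lemma has_partial_add:
  "has_partial \<mu> u D x \<Longrightarrow> has_partial \<mu> v E x \<Longrightarrow> has_partial \<mu> (\<lambda>x. u x + v x) (D + E) x"
  unfolding has_partial_def by (rule DERIV_add)

lemma has_partial_mult:
  "has_partial \<mu> u D x \<Longrightarrow> has_partial \<mu> v E x \<Longrightarrow>
     has_partial \<mu> (\<lambda>x. u x * v x) (D * v x + E * u x) x"
  unfolding has_partial_def by (drule (1) DERIV_mult) simp

lemma has_partial_compose:
  "has_partial \<mu> u D x \<Longrightarrow> (F has_real_derivative F') (at (u x)) \<Longrightarrow>
     has_partial \<mu> (\<lambda>x. F (u x)) (F' * D) x"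
  unfolding has_partial_def by (rule DERIV_chain2) simp_all

lemma differentiable_imp_has_partial:
  assumes "u differentiable (at x)"
  shows "has_partial \<mu> u (partial \<mu> u x) x"
proof -
  have "(\<lambda>h::real. x + h *\<^sub>R axis \<mu> 1) differentiable (at 0)" by simp
  then have "(u \<circ> (\<lambda>h::real. x + h *\<^sub>R axis \<mu> 1)) differentiable (at 0)"
    using assms by (intro differentiable_chain_at) auto
  then show ?thesis
    unfolding has_partial_def partial_def o_def real_differentiable_def
    using DERIV_imp_deriv by blast
qed

section \<open>Closure properties of C^k and smooth functions\<close>

lemma Ck_on_cong:
  assumes U: "open U" and "\<And>x. x \<in> U \<Longrightarrow> u x = v x"
  shows "Ck_on k U u \<longleftrightarrow> Ck_on k U v"
  using assms(2)
proof (induction k arbitrary: u v)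
  case 0
  then show ?case by (auto cong: continuous_on_cong)
next
  case (Suc k)
  have "u differentiable (at x) \<longleftrightarrow> v differentiable (at x)" if "x \<in> U" for x
    unfolding differentiable_def
    using has_derivative_transform_within_open[OF _ U that] Suc.prems by metis
  moreover have "Ck_on k U (partial \<mu> u) \<longleftrightarrow> Ck_on k U (partial \<mu> v)" for \<mu>
    using partial_cong[OF U] Suc.prems by (intro Suc.IH) blast
  ultimately show ?case by simp
qed

lemma Ck_on_SucD: "Ck_on (Suc k) U u \<Longrightarrow> Ck_on k U u"
proof (induction k arbitrary: u)
  case 0
  then show ?case
    by (auto intro!: continuous_at_imp_continuous_on differentiable_imp_continuous_within)
next
  case (Suc k)
  then show ?case by (metis Ck_on.simps(2))
qed

lemma Ck_on_const: "Ck_on k U (\<lambda>x. c)"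
proof (induction k arbitrary: c)
  case (Suc k)
  have "partial \<mu> (\<lambda>x. c) = (\<lambda>x. 0)" for \<mu>
    using partial_eq[OF has_partial_const] by blast
  then show ?case using Suc by simp
qed simp

lemma Ck_on_coord: "Ck_on k U (\<lambda>x. x $ i)"
proof (cases k)
  case (Suc m)
  have "partial \<mu> (\<lambda>x. x $ i) = (\<lambda>x. if i = \<mu> then 1 else 0)" for \<mu>
    using partial_eq[OF has_partial_coord] by blast
  moreover have "(\<lambda>x. x $ i) differentiable (at x)" for x :: "real ^ 4"
    by (rule bounded_linear_imp_differentiable) (rule bounded_linear_vec_nth)
  ultimately show ?thesis using Suc Ck_on_const by simp
qed (simp add: continuous_intros)

lemma Ck_on_add:
  assumes "open U" "Ck_on k U u" "Ck_on k U v"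
  shows "Ck_on k U (\<lambda>x. u x + v x)"
  using assms(2,3)
proof (induction k arbitrary: u v)
  case 0
  then show ?case by (simp add: continuous_on_add)
next
  case (Suc k)
  have "partial \<mu> (\<lambda>x. u x + v x) x = partial \<mu> u x + partial \<mu> v x" if "x \<in> U" for x \<mu>
    using Suc.prems that
    by (intro partial_eq has_partial_add differentiable_imp_has_partial) auto
  then have "Ck_on k U (partial \<mu> (\<lambda>x. u x + v x))" for \<mu>
    using Ck_on_cong[OF assms(1), of "partial \<mu> (\<lambda>x. u x + v x)"
        "\<lambda>x. partial \<mu> u x + partial \<mu> v x"]
      Suc.IH[of "partial \<mu> u" "partial \<mu> v"] Suc.prems by simp
  then show ?case using Suc.prems by (simp add: differentiable_add)
qed

lemma Ck_on_mult:
  assumes "open U" "Ck_on k U u" "Ck_on k U v"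
  shows "Ck_on k U (\<lambda>x. u x * v x)"
  using assms(2,3)
proof (induction k arbitrary: u v)
  case 0
  then show ?case by (simp add: continuous_on_mult)
next
  case (Suc k)
  have eq: "partial \<mu> (\<lambda>x. u x * v x) x = partial \<mu> u x * v x + partial \<mu> v x * u x"
    if "x \<in> U" for x \<mu>
    using Suc.prems that
    by (intro partial_eq has_partial_mult differentiable_imp_has_partial) auto
  have "Ck_on k U (\<lambda>x. partial \<mu> u x * v x + partial \<mu> v x * u x)" for \<mu>
    \<comment> \<open>The product rule keeps one factor undifferentiated, and
      \<open>Ck_on_SucD\<close> lowers its order to \<open>k\<close>.\<close>
    using Suc.prems Ck_on_SucD by (intro Ck_on_add[OF assms(1)] Suc.IH) auto
  then have "Ck_on k U (partial \<mu> (\<lambda>x. u x * v x))" for \<mu>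
    using Ck_on_cong[OF assms(1), of "partial \<mu> (\<lambda>x. u x * v x)"
        "\<lambda>x. partial \<mu> u x * v x + partial \<mu> v x * u x"] eq by simp
  then show ?case using Suc.prems by (simp add: differentiable_mult)
qed

text \<open>\<open>F\<close> lists the outer function with all its derivatives. The chain rule turns
  \<open>F n\<close> into \<open>F (Suc n)\<close> times a partial of \<open>u\<close>, so the
  induction on \<open>k\<close> has to treat all \<open>n\<close> at once. The set \<open>S\<close>
  admits outer functions such as \<open>ln\<close>, differentiable only on part of the line.\<close>

lemma Ck_on_compose:
  fixes F :: "nat \<Rightarrow> real \<Rightarrow> real"
  assumes U: "open U" and F: "\<And>n s. s \<in> S \<Longrightarrow> (F n has_real_derivative F (Suc n) s) (at s)"
    and "Ck_on k U u" and S: "\<And>x. x \<in> U \<Longrightarrow> u x \<in> S"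
  shows "Ck_on k U (\<lambda>x. F n (u x))"
  using assms(3)
proof (induction k arbitrary: n)
  case 0
  have "continuous_on S (F n)"
    using F DERIV_isCont continuous_at_imp_continuous_on by blast
  then show ?case
    using 0 S continuous_on_compose2[of S "F n" U u] by (simp add: image_subset_iff)
next
  case (Suc k)
  have u: "u differentiable (at x)" if "x \<in> U" for x
    using Suc.prems that by simp
  have eq: "partial \<mu> (\<lambda>x. F n (u x)) x = F (Suc n) (u x) * partial \<mu> u x"
    if "x \<in> U" for x \<mu>
    using that u F S by (intro partial_eq has_partial_compose differentiable_imp_has_partial) auto
  have "Ck_on k U (\<lambda>x. F (Suc n) (u x) * partial \<mu> u x)" for \<mu>
    using Suc.prems Ck_on_SucD by (intro Ck_on_mult[OF U] Suc.IH) auto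
  then have "Ck_on k U (partial \<mu> (\<lambda>x. F n (u x)))" for \<mu>
    using Ck_on_cong[OF U, of "partial \<mu> (\<lambda>x. F n (u x))"
        "\<lambda>x. F (Suc n) (u x) * partial \<mu> u x"] eq by simp
  moreover have "(\<lambda>x. F n (u x)) differentiable (at x)" if "x \<in> U" for x
    using differentiable_compose[of "F n" u x UNIV] F[OF S[OF that], of n] u[OF that]
    by (metis differentiable_at_withinI real_differentiable_def)
  ultimately show ?case by simp
qed

lemma smooth_on_cong:
  "open U \<Longrightarrow> (\<And>x. x \<in> U \<Longrightarrow> u x = v x) \<Longrightarrow> smooth_on U u \<longleftrightarrow> smooth_on U v"
  unfolding smooth_on_def using Ck_on_cong by blast

lemma smooth_on_const: "smooth_on U (\<lambda>x. c)"
  unfolding smooth_on_def using Ck_on_const by blast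

lemma smooth_on_coord: "smooth_on U (\<lambda>x. x $ i)"
  unfolding smooth_on_def using Ck_on_coord by blast

lemma smooth_on_add:
  "open U \<Longrightarrow> smooth_on U u \<Longrightarrow> smooth_on U v \<Longrightarrow> smooth_on U (\<lambda>x. u x + v x)"
  unfolding smooth_on_def using Ck_on_add by blast

lemma smooth_on_mult:
  "open U \<Longrightarrow> smooth_on U u \<Longrightarrow> smooth_on U v \<Longrightarrow> smooth_on U (\<lambda>x. u x * v x)"
  unfolding smooth_on_def using Ck_on_mult by blast

lemma smooth_on_exp:
  "open U \<Longrightarrow> smooth_on U u \<Longrightarrow> smooth_on U (\<lambda>x. exp (u x))"
  unfolding smooth_on_def
  using Ck_on_compose[of U UNIV "\<lambda>n. exp"] by (metis DERIV_exp UNIV_I)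

lemma smooth_on_sin:
  assumes "open U" "smooth_on U u" shows "smooth_on U (\<lambda>x. sin (u x))"
proof -
  \<comment> \<open>Differentiation shifts the argument of sine by a quarter period, so one formula
    gives all derivatives.\<close>
  have "((\<lambda>s. sin (s + real n * pi / 2)) has_real_derivative sin (s + real (Suc n) * pi / 2)) (at s)"
    for n s
  proof -
    have "sin (s + real (Suc n) * pi / 2) = sin (s + real n * pi / 2 + pi / 2)"
      by (simp add: algebra_simps add_divide_distrib)
    also have "\<dots> = cos (s + real n * pi / 2)"
      by (simp only: sin_add cos_pi_half sin_pi_half)
    finally have "sin (s + real (Suc n) * pi / 2) = cos (s + real n * pi / 2)" .
    moreover have "((\<lambda>s. sin (s + real n * pi / 2)) has_real_derivative
        cos (s + real n * pi / 2) * (1 + 0)) (at s)"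
      by (intro DERIV_fun_sin DERIV_add DERIV_ident DERIV_const)
    ultimately show ?thesis by simp
  qed
  from Ck_on_compose[OF assms(1), of UNIV "\<lambda>n s. sin (s + real n * pi / 2)" _ _ 0, OF this]
  show ?thesis using assms(2) unfolding smooth_on_def by simp
qed

lemma smooth_on_ln:
  assumes "open U" "smooth_on U u" "\<And>x. x \<in> U \<Longrightarrow> u x > 0"
  shows "smooth_on U (\<lambda>x. ln (u x))"
proof -
  define F :: "nat \<Rightarrow> real \<Rightarrow> real" where
    "F n = (case n of 0 \<Rightarrow> ln | Suc m \<Rightarrow> \<lambda>s. (-1) ^ m * fact m * inverse s ^ Suc m)" for n
  have "(F n has_real_derivative F (Suc n) s) (at s)" if "s \<in> {0<..}" for n s
  proof (cases n)
    case 0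
    then show ?thesis using that by (auto simp: F_def divide_inverse intro!: derivative_eq_intros)
  next
    case (Suc m)
    have "((\<lambda>s. (-1) ^ m * fact m * inverse s ^ Suc m) has_real_derivative
        (-1) ^ m * fact m * ((1 + real m) * (- (inverse s ^ Suc (Suc 0)) * inverse s ^ m))) (at s)"
      using that by (intro DERIV_cmult DERIV_power_Suc DERIV_inverse) auto
    also have "(-1) ^ m * fact m * ((1 + real m) * (- (inverse s ^ Suc (Suc 0)) * inverse s ^ m))
        = (-1) ^ Suc m * fact (Suc m) * inverse s ^ Suc (Suc m)"
      by (simp add: algebra_simps)
    finally have "((\<lambda>s. (-1) ^ m * fact m * inverse s ^ Suc m) has_real_derivative
        (-1) ^ Suc m * fact (Suc m) * inverse s ^ Suc (Suc m)) (at s)" .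
    then show ?thesis using Suc by (simp add: F_def)
  qed
  from Ck_on_compose[OF assms(1), of "{0<..}" F _ _ 0, OF this]
  show ?thesis using assms(2,3) unfolding smooth_on_def by (simp add: F_def)
qed

subsection \<open>Curvature of diagonal metrics\<close>

lemma matrix_inv_eqI:
  fixes A B :: "real ^ 'n ^ 'n"
  assumes "A ** B = mat 1" "B ** A = mat 1"
  shows "matrix_inv A = B"
proof -
  have "\<exists>B. A ** B = mat 1 \<and> B ** A = mat 1"
    using assms by blast
  from someI_ex[OF this] have inv: "A ** matrix_inv A = mat 1 \<and> matrix_inv A ** A = mat 1"
    unfolding matrix_inv_def .
  have "matrix_inv A = (B ** A) ** matrix_inv A"
    by (simp only: assms matrix_mul_lid)
  also have "\<dots> = B"
    by (simp only: inv matrix_mul_assoc[symmetric] matrix_mul_rid)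
  finally show ?thesis .
qed

lemma matrix_inv_diagonal:
  fixes A :: "real ^ 'n ^ 'n"
  assumes "\<And>i j. A $ i $ j = (if i = j then d i else 0)" "\<And>i. d i \<noteq> 0"
  shows "matrix_inv A $ i $ j = (if i = j then 1 / d i else 0)"
proof -
  define B :: "real ^ 'n ^ 'n" where "B = (\<chi> i j. if i = j then 1 / d i else 0)"
  have "matrix_inv A = B"
    by (rule matrix_inv_eqI)
      (use assms in \<open>simp_all add: vec_eq_iff matrix_matrix_mult_def B_def mat_def
        if_distrib[where f = "\<lambda>t. _ * t"] if_distrib[where f = "\<lambda>t. t * _"] cong: if_cong\<close>)
  then show ?thesis by (simp add: B_def)
qed

text \<open>\<open>p \<mu> \<nu>\<close> is half the logarithmic derivative of
  \<open>G \<mu>\<close>; the multiplied-out form in \<open>dG\<close> makes sense for the negative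
  component too. \<open>q_sym\<close> is the equality of mixed second derivatives; as an assumption
  it can be read off explicit formulas instead of being derived from Schwarz's theorem.\<close>

locale diagonal_metric =
  fixes U :: "(real ^ 4) set" and g :: "real ^ 4 \<Rightarrow> real ^ 4 ^ 4"
    and G :: "4 \<Rightarrow> real ^ 4 \<Rightarrow> real"
    and p :: "4 \<Rightarrow> 4 \<Rightarrow> real ^ 4 \<Rightarrow> real"
    and q :: "4 \<Rightarrow> 4 \<Rightarrow> 4 \<Rightarrow> real ^ 4 \<Rightarrow> real"
  assumes open_U: "open U"
    and g_eq: "x \<in> U \<Longrightarrow> g x $ \<mu> $ \<nu> = (if \<mu> = \<nu> then G \<mu> x else 0)"
    and G_nz: "x \<in> U \<Longrightarrow> G \<mu> x \<noteq> 0"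
    and dG: "x \<in> U \<Longrightarrow> has_partial \<nu> (G \<mu>) (2 * p \<mu> \<nu> x * G \<mu> x) x"
    and dp: "x \<in> U \<Longrightarrow> has_partial \<sigma> (p \<mu> \<nu>) (q \<mu> \<nu> \<sigma> x) x"
    and q_sym: "x \<in> U \<Longrightarrow> q \<mu> \<nu> \<sigma> x = q \<mu> \<sigma> \<nu> x"
begin

lemma inv_metric_eq:
  "x \<in> U \<Longrightarrow> inv_metric g \<mu> \<nu> x = (if \<mu> = \<nu> then 1 / G \<mu> x else 0)"
  unfolding inv_metric_def by (rule matrix_inv_diagonal) (simp_all add: g_eq G_nz)

lemma partial_g:
  assumes "x \<in> U"
  shows "partial \<sigma> (\<lambda>y. g y $ \<mu> $ \<nu>) x = (if \<mu> = \<nu> then 2 * p \<mu> \<sigma> x * G \<mu> x else 0)"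
proof -
  have "partial \<sigma> (\<lambda>y. g y $ \<mu> $ \<nu>) x = partial \<sigma> (\<lambda>y. if \<mu> = \<nu> then G \<mu> y else 0) x"
    using g_eq by (intro partial_cong[OF open_U assms])
  then show ?thesis
    using partial_eq[OF dG[OF assms]] partial_eq[OF has_partial_const] by simp
qed

lemma christoffel_eq:
  assumes "x \<in> U"
  shows "christoffel g l \<mu> \<nu> x = (if l = \<nu> then p l \<mu> x else 0) + (if l = \<mu> then p l \<nu> x else 0)
    - (if \<mu> = \<nu> then p \<mu> l x * G \<mu> x * (1 / G l x) else 0)"
proof -
  have "christoffel g l \<mu> \<nu> x = (\<Sum>\<sigma>\<in>UNIV. if \<sigma> = l then 1 / G l x / 2 *
     (partial \<mu> (\<lambda>y. g y $ l $ \<nu>) x + partial \<nu> (\<lambda>y. g y $ l $ \<mu>) x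
      - partial l (\<lambda>y. g y $ \<mu> $ \<nu>) x) else 0)"
    unfolding christoffel_def inv_metric_eq[OF assms]
    by (intro sum.cong) (auto simp: add_divide_distrib diff_divide_distrib)
  also have "\<dots> = 1 / G l x / 2 *
     (partial \<mu> (\<lambda>y. g y $ l $ \<nu>) x + partial \<nu> (\<lambda>y. g y $ l $ \<mu>) x
      - partial l (\<lambda>y. g y $ \<mu> $ \<nu>) x)"
    by (subst sum.delta) simp_all
  also have "\<dots> = (if l = \<nu> then p l \<mu> x else 0) + (if l = \<mu> then p l \<nu> x else 0)
    - (if \<mu> = \<nu> then p \<mu> l x * G \<mu> x * (1 / G l x) else 0)"
    using G_nz[OF assms] by (auto simp: partial_g[OF assms] field_simps)
  finally show ?thesis .
qed

text \<open>The ratio occurring in a Christoffel symbol reproduces itself under differentiation, so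
  the curvature involves only \<open>p\<close>, \<open>q\<close> and the same ratios.\<close>

lemma has_partial_ratio:
  assumes "x \<in> U"
  shows "has_partial \<sigma> (\<lambda>y. G \<mu> y * (1 / G l y))
    (2 * (p \<mu> \<sigma> x - p l \<sigma> x) * (G \<mu> x * (1 / G l x))) x"
proof -
  have "((\<lambda>s. 1 / s) has_real_derivative - (1 / (G l x)\<^sup>2)) (at (G l x))"
    using G_nz[OF assms] by (auto intro!: derivative_eq_intros simp: power2_eq_square)
  from has_partial_mult[OF dG[OF assms] has_partial_compose[OF dG[OF assms] this]]
  have "has_partial \<sigma> (\<lambda>y. G \<mu> y * (1 / G l y)) (2 * p \<mu> \<sigma> x * G \<mu> x * (1 / G l x)
    + - (1 / (G l x)\<^sup>2) * (2 * p l \<sigma> x * G l x) * G \<mu> x) x" .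
  moreover have "2 * p \<mu> \<sigma> x * G \<mu> x * (1 / G l x)
    + - (1 / (G l x)\<^sup>2) * (2 * p l \<sigma> x * G l x) * G \<mu> x
    = 2 * (p \<mu> \<sigma> x - p l \<sigma> x) * (G \<mu> x * (1 / G l x))"
    using G_nz[OF assms] by (simp add: field_simps power2_eq_square)
  ultimately show ?thesis by simp
qed

lemma partial_christoffel:
  assumes "x \<in> U"
  shows "partial \<sigma> (christoffel g l \<mu> \<nu>) x =
    (if l = \<nu> then q l \<mu> \<sigma> x else 0) + (if l = \<mu> then q l \<nu> \<sigma> x else 0)
    - (if \<mu> = \<nu> then (q \<mu> l \<sigma> x + 2 * p \<mu> l x * (p \<mu> \<sigma> x - p l \<sigma> x)) * (G \<mu> x * (1 / G l x)) else 0)"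
proof -
  have if_partial: "has_partial \<sigma> (\<lambda>y. if b then u y else 0) (if b then D else 0) x"
    if "has_partial \<sigma> u D x" for b u D
    using that has_partial_const by (cases b) auto
  have "partial \<sigma> (christoffel g l \<mu> \<nu>) x = partial \<sigma> (\<lambda>x. ((if l = \<nu> then p l \<mu> x else 0)
      + (if l = \<mu> then p l \<nu> x else 0))
      + (-1) * (if \<mu> = \<nu> then p \<mu> l x * (G \<mu> x * (1 / G l x)) else 0)) x"
    by (rule partial_cong[OF open_U assms]) (simp add: christoffel_eq)
  also have "\<dots> = ((if l = \<nu> then q l \<mu> \<sigma> x else 0) + (if l = \<mu> then q l \<nu> \<sigma> x else 0))
    + (0 * (if \<mu> = \<nu> then p \<mu> l x * (G \<mu> x * (1 / G l x)) else 0) +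
       (if \<mu> = \<nu> then q \<mu> l \<sigma> x * (G \<mu> x * (1 / G l x)) +
         2 * (p \<mu> \<sigma> x - p l \<sigma> x) * (G \<mu> x * (1 / G l x)) * p \<mu> l x else 0) * (-1))"
    by (intro partial_eq has_partial_add has_partial_mult if_partial has_partial_const dp
        has_partial_ratio assms)
  finally show ?thesis by (cases "\<mu> = \<nu>") (simp_all add: G_nz[OF assms] algebra_simps)
qed

section \<open>Ricci tensor, wave operator and Einstein tensor in terms of p and q\<close>

lemma ricci_offdiagonal:
  assumes "x \<in> U" "\<mu> \<noteq> \<nu>"
  shows "ricci g \<mu> \<nu> x = (\<Sum>l\<in>UNIV - {\<mu>, \<nu>}.
    p l \<mu> x * (p \<mu> \<nu> x - p l \<nu> x) + p l \<nu> x * p \<nu> \<mu> x - q l \<mu> \<nu> x)"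
proof -
  have "ricci g \<mu> \<nu> x = (\<Sum>l\<in>UNIV. if l = \<mu> \<or> l = \<nu> then 0 else
    p l \<mu> x * (p \<mu> \<nu> x - p l \<nu> x) + p l \<nu> x * p \<nu> \<mu> x - q l \<mu> \<nu> x)"
    \<comment> \<open>Every index pair is expanded. The instances of \<open>q_sym\<close> at
      descending pairs put mixed derivatives in increasing order, so that the terms with
      \<open>l\<close> equal to \<open>\<mu>\<close> or \<open>\<nu>\<close> cancel; a ratio of two
      different components only ever meets its reciprocal.\<close>
    using exhaust4[of \<mu>] exhaust4[of \<nu>] assms(2)
    unfolding ricci_def sum4 christoffel_eq[OF assms(1)] partial_christoffel[OF assms(1)]
    by (elim disjE)
      (simp_all add: neq4 neq4[symmetric] q_sym[OF assms(1), of _ 1 0] q_sym[OF assms(1), of _ 2 0]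
        q_sym[OF assms(1), of _ 3 0] q_sym[OF assms(1), of _ 2 1] q_sym[OF assms(1), of _ 3 1]
        q_sym[OF assms(1), of _ 3 2] G_nz[OF assms(1)],
       simp_all add: algebra_simps G_nz[OF assms(1)])
  also have "\<dots> = (\<Sum>l\<in>UNIV - {\<mu>, \<nu>}.
    p l \<mu> x * (p \<mu> \<nu> x - p l \<nu> x) + p l \<nu> x * p \<nu> \<mu> x - q l \<mu> \<nu> x)"
    by (rule sum.mono_neutral_cong_right) auto
  finally show ?thesis .
qed

text \<open>The last bracket divided by \<open>G l\<close> is the \<open>l\<close> term of the wave
  operator applied to half of ln |G_mu| (compare \<open>dalembertian_eq\<close>). It comes from the
  divergence of the symbols with both lower indices \<open>\<mu>\<close>; the squares of
  \<open>p \<mu> l\<close> produced there cancel against the products subtracted in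
  \<open>ricci\<close>.\<close>

lemma ricci_diagonal:
  assumes "x \<in> U"
  shows "ricci g \<mu> \<mu> x = (\<Sum>l\<in>UNIV - {\<mu>}.
    p l \<mu> x * (p \<mu> \<mu> x - p l \<mu> x) - q l \<mu> \<mu> x
    - G \<mu> x / G l x * (q \<mu> l l x + p \<mu> l x * (\<Sum>m\<in>UNIV. p m l x) - 2 * p \<mu> l x * p l l x))"
proof -
  have "\<forall>\<mu>. ricci g \<mu> \<mu> x = (\<Sum>l\<in>UNIV. if l = \<mu> then 0 else
    p l \<mu> x * (p \<mu> \<mu> x - p l \<mu> x) - q l \<mu> \<mu> x
    - G \<mu> x * (1 / G l x) * (q \<mu> l l x + p \<mu> l x * (\<Sum>m\<in>UNIV. p m l x) - 2 * p \<mu> l x * p l l x))"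
    using G_nz[OF assms(1)]
    unfolding ricci_def sum4 christoffel_eq[OF assms(1)] partial_christoffel[OF assms(1)] forall_4 four_eq_zero
    by (simp add: neq4 neq4[symmetric] algebra_simps)
  then have "ricci g \<mu> \<mu> x = (\<Sum>l\<in>UNIV. if l = \<mu> then 0 else
    p l \<mu> x * (p \<mu> \<mu> x - p l \<mu> x) - q l \<mu> \<mu> x
    - G \<mu> x * (1 / G l x) * (q \<mu> l l x + p \<mu> l x * (\<Sum>m\<in>UNIV. p m l x) - 2 * p \<mu> l x * p l l x))"
    by blast
  also have "\<dots> = (\<Sum>l\<in>UNIV - {\<mu>}.
    p l \<mu> x * (p \<mu> \<mu> x - p l \<mu> x) - q l \<mu> \<mu> x
    - G \<mu> x / G l x * (q \<mu> l l x + p \<mu> l x * (\<Sum>m\<in>UNIV. p m l x) - 2 * p \<mu> l x * p l l x))"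
    by (rule sum.mono_neutral_cong_right) auto
  finally show ?thesis .
qed

lemma sum_inv_metric:
  assumes "x \<in> U"
  shows "(\<Sum>\<mu>\<in>UNIV. \<Sum>\<nu>\<in>UNIV. inv_metric g \<mu> \<nu> x * h \<mu> \<nu>) = (\<Sum>\<mu>\<in>UNIV. h \<mu> \<mu> / G \<mu> x)"
proof -
  have "(\<Sum>\<nu>\<in>UNIV. inv_metric g \<mu> \<nu> x * h \<mu> \<nu>) = h \<mu> \<mu> / G \<mu> x" for \<mu>
  proof -
    have "(\<Sum>\<nu>\<in>UNIV. inv_metric g \<mu> \<nu> x * h \<mu> \<nu>)
        = (\<Sum>\<nu>\<in>UNIV. if \<mu> = \<nu> then h \<mu> \<nu> / G \<mu> x else 0)"
      using assms by (intro sum.cong) (auto simp: inv_metric_eq)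
    then show ?thesis by simp
  qed
  then show ?thesis by simp
qed

lemma dalembertian_eq:
  assumes "x \<in> U"
  shows "dalembertian g \<phi> x = (\<Sum>\<mu>\<in>UNIV. (partial \<mu> (partial \<mu> \<phi>) x
     + partial \<mu> \<phi> x * ((\<Sum>\<nu>\<in>UNIV. p \<nu> \<mu> x) - 2 * p \<mu> \<mu> x)) / G \<mu> x)"
  using G_nz[OF assms]
  unfolding dalembertian_def sum_inv_metric[OF assms, of "\<lambda>\<mu> \<nu>. hessian g \<phi> \<mu> \<nu> x"]
  unfolding hessian_def christoffel_eq[OF assms] sum4
  by (simp add: neq4 neq4[symmetric] algebra_simps add_divide_distrib diff_divide_distrib)

text \<open>The trace of the hypothesis is kappa (N + 4 v), with N the squared length of
  \<open>d\<close> and 4 the dimension. Subtracting half of it times the metric turns + v into - N/2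
  - v.\<close>

lemma einstein_tensor_eqI:
  assumes x: "x \<in> U"
    and ric: "\<And>\<mu> \<nu>. ricci g \<mu> \<nu> x = \<kappa> * (d \<mu> * d \<nu> + g x $ \<mu> $ \<nu> * v)"
  shows "einstein_tensor g \<mu> \<nu> x = \<kappa> * (d \<mu> * d \<nu> - g x $ \<mu> $ \<nu> *
    (1 / 2 * (\<Sum>\<alpha>\<in>UNIV. \<Sum>\<beta>\<in>UNIV. inv_metric g \<alpha> \<beta> x * d \<alpha> * d \<beta>) + v))"
proof -
  define N where "N = (\<Sum>\<alpha>\<in>UNIV. d \<alpha> * d \<alpha> / G \<alpha> x)"
  have N: "(\<Sum>\<alpha>\<in>UNIV. \<Sum>\<beta>\<in>UNIV. inv_metric g \<alpha> \<beta> x * d \<alpha> * d \<beta>) = N"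
    using sum_inv_metric[OF x, of "\<lambda>\<alpha> \<beta>. d \<alpha> * d \<beta>"] by (simp add: N_def mult.assoc)
  have "scalar_curvature g x = (\<Sum>\<mu>\<in>UNIV. \<kappa> * (d \<mu> * d \<mu> / G \<mu> x) + \<kappa> * v)"
    unfolding scalar_curvature_def sum_inv_metric[OF x] ric
    using G_nz[OF x] by (intro sum.cong) (auto simp: g_eq[OF x] field_simps)
  also have "\<dots> = \<kappa> * (N + 4 * v)"
    by (simp add: N_def sum.distrib sum_distrib_left distrib_left)
  finally show ?thesis
    unfolding einstein_tensor_def N ric by (simp add: field_simps)
qed

end

subsection \<open>The metric in logarithmic form\<close>

definition vec4 :: "'a \<Rightarrow> 'a \<Rightarrow> 'a \<Rightarrow> 'a \<Rightarrow> 4 \<Rightarrow> 'a" where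
  "vec4 a b c d i = (if i = 0 then a else if i = 1 then b else if i = 2 then c else d)"

lemma vec4_simps [simp]:
  "vec4 a b c d 0 = a" "vec4 a b c d 1 = b" "vec4 a b c d 2 = c" "vec4 a b c d 3 = d"
  by (simp_all add: vec4_def)

lemma lorentzian_diag4:
  fixes A :: "real ^ 4 ^ 4"
  assumes "G 0 < 0" "\<And>i. i \<noteq> 0 \<Longrightarrow> G i > 0" "\<And>i j. A $ i $ j = (if i = j then G i else 0)"
  shows "\<exists>P. invertible P \<and> transpose P ** A ** P = diag4 (-1) 1 1 1"
proof -
  define B :: "(4 \<Rightarrow> real) \<Rightarrow> real ^ 4 ^ 4" where
    "B d = (\<chi> i j. if i = j then d i else 0)" for d
  \<comment> \<open>The orthonormal frame is the coordinate basis rescaled to unit length: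
    \<open>P\<close> is diagonal with entries \<open>1 / s i\<close>.\<close>
  define s where "s i = sqrt \<bar>G i\<bar>" for i
  have BB: "B d ** B e = B (\<lambda>i. d i * e i)" for d e
    by (simp add: B_def vec_eq_iff matrix_matrix_mult_def
      if_distrib[where f = "\<lambda>t. _ * t"] if_distrib[where f = "\<lambda>t. t * _"] cong: if_cong)
  have nz: "G i \<noteq> 0" for i using assms(1) assms(2)[of i] by (cases "i = 0") auto
  then have s: "s i \<noteq> 0" "s i * s i = \<bar>G i\<bar>" for i by (simp_all add: s_def)
  have "B (\<lambda>i. 1) = mat 1" by (simp add: B_def mat_def vec_eq_iff)
  then have "invertible (B (\<lambda>i. 1 / s i))"
    unfolding invertible_def using BB[of s "\<lambda>i. 1 / s i"] BB[of "\<lambda>i. 1 / s i" s] s(1) by auto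
  moreover have "transpose (B (\<lambda>i. 1 / s i)) = B (\<lambda>i. 1 / s i)"
    by (simp add: B_def transpose_def vec_eq_iff)
  moreover have "A = B G" by (simp add: B_def vec_eq_iff assms(3))
  moreover have "1 / s i * G i * (1 / s i) = (if i = 0 then - 1 else 1)" for i
  proof -
    have "1 / s i * G i * (1 / s i) = G i / \<bar>G i\<bar>" by (simp add: s(2)[symmetric])
    then show ?thesis using assms(1) assms(2)[of i] by auto
  qed
  then have "B (\<lambda>i. 1 / s i * G i * (1 / s i)) = diag4 (-1) 1 1 1"
    by (simp add: B_def diag4_def vec_eq_iff)
  ultimately show ?thesis by (metis BB)
qed

text \<open>\<open>n\<close> stands for \<open>\<xi>\<^sub>2\<close>. Leaving it arbitrary keeps the
  coupling constants out of the geometry.\<close>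

locale zv_cosmology =
  fixes M \<delta> C \<beta> n :: real
  assumes M_pos: "M > 0" and C_nz: "C \<noteq> 0"
begin

text \<open>The condition on the product \<open>C * x $ 0\<close> covers both signs of
  \<open>C\<close> at once.\<close>

definition chart :: "(real ^ 4) set" where
  "chart = {x. C * x $ 0 > 0 \<and> 2 * M < x $ 1 \<and> 0 < x $ 2 \<and> x $ 2 < pi}"

definition D :: "real \<Rightarrow> real" where "D r = (r - M)\<^sup>2 - M\<^sup>2"
definition Q :: "real \<Rightarrow> real \<Rightarrow> real" where "Q r \<theta> = D r + M\<^sup>2 * (sin \<theta>)\<^sup>2"

text \<open>Coefficients of ln f, ln D, ln Q and ln sin theta in half of ln |G_mu|. They are read
  off from f / g = D / Q, r^2 g = Q and r^2 f = D, so that ln f itself survives only with the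
  exponent delta beta.\<close>

definition cf where "cf = vec4 (\<delta> * \<beta> / 2) (- \<delta> * \<beta> / 2) (- \<delta> * \<beta> / 2) (- \<delta> * \<beta> / 2)"
definition cD where "cD = vec4 0 ((\<delta>\<^sup>2 - 1) / 2) (\<delta>\<^sup>2 / 2) (1 / 2)"
definition cQ where "cQ = vec4 0 ((1 - \<delta>\<^sup>2) / 2) ((1 - \<delta>\<^sup>2) / 2) 0"
definition cs where "cs = vec4 0 0 0 (1 :: real)"

lemma coefficients:
  "cf 0 = \<delta> * \<beta> / 2" "cf 1 = - (\<delta> * \<beta> / 2)" "cf 2 = - (\<delta> * \<beta> / 2)" "cf 3 = - (\<delta> * \<beta> / 2)"
  "cD 0 = 0" "cD 1 = (\<delta>\<^sup>2 - 1) / 2" "cD 2 = \<delta>\<^sup>2 / 2" "cD 3 = 1 / 2"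
  "cQ 0 = 0" "cQ 1 = (1 - \<delta>\<^sup>2) / 2" "cQ 2 = (1 - \<delta>\<^sup>2) / 2" "cQ 3 = 0"
  "cs 0 = 0" "cs 1 = 0" "cs 2 = 0" "cs 3 = 1"
  by (simp_all add: cf_def cD_def cQ_def cs_def)

definition W :: "4 \<Rightarrow> real ^ 4 \<Rightarrow> real" where
  "W \<mu> x = n * ln (C * x $ 0) + cf \<mu> * ln (1 - 2 * M / x $ 1) + cD \<mu> * ln (D (x $ 1))
     + cQ \<mu> * ln (Q (x $ 1) (x $ 2)) + cs \<mu> * ln (sin (x $ 2))"

text \<open>A sign times an exponential never vanishes and has an immediate logarithmic derivative.
  \<open>G_closed_form\<close> ties it to the powers in the stated metric.\<close>

definition G :: "4 \<Rightarrow> real ^ 4 \<Rightarrow> real" where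
  "G \<mu> x = vec4 (-1) 1 1 1 \<mu> * exp (2 * W \<mu> x)"

definition p :: "4 \<Rightarrow> 4 \<Rightarrow> real ^ 4 \<Rightarrow> real" where
  "p \<mu> \<nu> x = (let r = x $ 1; \<theta> = x $ 2 in vec4
     (n / x $ 0)
     (cf \<mu> * (2 * M / D r) + cD \<mu> * (2 * (r - M) / D r) + cQ \<mu> * (2 * (r - M) / Q r \<theta>))
     (cQ \<mu> * (2 * M\<^sup>2 * sin \<theta> * cos \<theta> / Q r \<theta>) + cs \<mu> * (cos \<theta> / sin \<theta>))
     0 \<nu>)"

text \<open>The mixed time-space entries vanish because \<open>W\<close> is a function of time plus
  a function of r and theta. The factor 1 + cot^2 is minus the derivative of cot.\<close>

definition q :: "4 \<Rightarrow> 4 \<Rightarrow> 4 \<Rightarrow> real ^ 4 \<Rightarrow> real" where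
  "q \<mu> \<nu> \<sigma> x = (let r = x $ 1; \<theta> = x $ 2 in vec4
     (vec4 (- n / (x $ 0)\<^sup>2) 0 0 0 \<sigma>)
     (vec4 0
        (cf \<mu> * (- 4 * M * (r - M) / (D r)\<^sup>2) + cD \<mu> * (2 / D r - 4 * (r - M)\<^sup>2 / (D r)\<^sup>2)
          + cQ \<mu> * (2 / Q r \<theta> - 4 * (r - M)\<^sup>2 / (Q r \<theta>)\<^sup>2))
        (cQ \<mu> * (- 4 * (r - M) * M\<^sup>2 * sin \<theta> * cos \<theta> / (Q r \<theta>)\<^sup>2)) 0 \<sigma>)
     (vec4 0
        (cQ \<mu> * (- 4 * (r - M) * M\<^sup>2 * sin \<theta> * cos \<theta> / (Q r \<theta>)\<^sup>2))
        (cQ \<mu> * (2 * M\<^sup>2 * ((cos \<theta>)\<^sup>2 - (sin \<theta>)\<^sup>2) / Q r \<theta>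
            - (2 * M\<^sup>2 * sin \<theta> * cos \<theta>)\<^sup>2 / (Q r \<theta>)\<^sup>2)
          - cs \<mu> * (1 + (cos \<theta> / sin \<theta>)\<^sup>2)) 0 \<sigma>)
     0 \<nu>)"

section \<open>Positivity on the chart and derivatives of the logarithmic form\<close>

lemma chartD:
  assumes "x \<in> chart"
  shows "C * x $ 0 > 0" "x $ 0 \<noteq> 0" "x $ 1 > 0" "1 - 2 * M / x $ 1 > 0" "D (x $ 1) > 0"
    "Q (x $ 1) (x $ 2) > 0" "sin (x $ 2) > 0"
proof -
  show "C * x $ 0 > 0" "x $ 0 \<noteq> 0" "x $ 1 > 0" "sin (x $ 2) > 0"
    using assms M_pos by (auto simp: chart_def intro: sin_gt_zero)
  show "1 - 2 * M / x $ 1 > 0" using assms M_pos by (auto simp: chart_def field_simps)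
  have "x $ 1 * (x $ 1 - 2 * M) > 0" using assms M_pos by (auto simp: chart_def)
  then show D: "D (x $ 1) > 0" by (simp add: D_def power2_eq_square algebra_simps)
  then show "Q (x $ 1) (x $ 2) > 0" unfolding Q_def by (simp add: add_pos_nonneg)
qed

lemma open_chart: "open chart"
  unfolding chart_def by (intro open_Collect_conj open_Collect_less continuous_intros)

lemma has_derivative_D [derivative_intros]:
  "(u has_real_derivative u') (at s) \<Longrightarrow>
    ((\<lambda>s. D (u s)) has_real_derivative 2 * (u s - M) * u') (at s)"
  unfolding D_def by (auto intro!: derivative_eq_intros)

lemma has_derivative_Q [derivative_intros]:
  "(u has_real_derivative u') (at s) \<Longrightarrow> (v has_real_derivative v') (at s) \<Longrightarrow>
    ((\<lambda>s. Q (u s) (v s)) has_real_derivative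
      2 * (u s - M) * u' + 2 * M\<^sup>2 * sin (v s) * cos (v s) * v') (at s)"
  unfolding Q_def by (auto intro!: derivative_eq_intros)

text \<open>This cancels the r^2 in the logarithmic derivative of f and leaves 2 M / D.\<close>

lemma D_eq: "r \<noteq> 0 \<Longrightarrow> 1 - 2 * M / r = D r / r\<^sup>2"
  by (simp add: D_def power2_eq_square field_simps)

lemma has_partial_components:
  assumes "x \<in> chart"
  shows "has_partial \<nu> (\<lambda>x. ln (C * x $ 0)) (vec4 (1 / x $ 0) 0 0 0 \<nu>) x"
    "has_partial \<nu> (\<lambda>x. ln (1 - 2 * M / x $ 1)) (vec4 0 (2 * M / D (x $ 1)) 0 0 \<nu>) x"
    "has_partial \<nu> (\<lambda>x. ln (D (x $ 1))) (vec4 0 (2 * (x $ 1 - M) / D (x $ 1)) 0 0 \<nu>) x"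
    "has_partial \<nu> (\<lambda>x. ln (Q (x $ 1) (x $ 2))) (vec4 0 (2 * (x $ 1 - M) / Q (x $ 1) (x $ 2))
        (2 * M\<^sup>2 * sin (x $ 2) * cos (x $ 2) / Q (x $ 1) (x $ 2)) 0 \<nu>) x"
    "has_partial \<nu> (\<lambda>x. ln (sin (x $ 2))) (vec4 0 0 (cos (x $ 2) / sin (x $ 2)) 0 \<nu>) x"
proof -
  note [simp] = chartD[OF assms] axis_def neq4 neq4[symmetric]
  have f: "1 - 2 * M / x $ 1 = D (x $ 1) / (x $ 1)\<^sup>2" by (rule D_eq) (use chartD(3)[OF assms] in linarith)
  have \<nu>: "\<nu> = 0 \<or> \<nu> = 1 \<or> \<nu> = 2 \<or> \<nu> = 3" by (rule exhaust4)
  note nz = chartD(5,6)[OF assms, THEN less_imp_neq, symmetric]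
    chartD(3)[OF assms, THEN less_imp_neq, symmetric]
  note [simp] = nz
  show "has_partial \<nu> (\<lambda>x. ln (C * x $ 0)) (vec4 (1 / x $ 0) 0 0 0 \<nu>) x"
    using \<nu> unfolding has_partial_def
    by (elim disjE) (auto intro!: derivative_eq_intros simp: C_nz)
  show "has_partial \<nu> (\<lambda>x. ln (1 - 2 * M / x $ 1)) (vec4 0 (2 * M / D (x $ 1)) 0 0 \<nu>) x"
    using \<nu> nz chartD(3,4)[OF assms] unfolding has_partial_def
    by (elim disjE) (auto intro!: derivative_eq_intros simp: f power2_eq_square)
  show "has_partial \<nu> (\<lambda>x. ln (D (x $ 1))) (vec4 0 (2 * (x $ 1 - M) / D (x $ 1)) 0 0 \<nu>) x"
    using \<nu> nz chartD(5)[OF assms] unfolding has_partial_def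
    by (elim disjE) (auto intro!: derivative_eq_intros)
  show "has_partial \<nu> (\<lambda>x. ln (Q (x $ 1) (x $ 2))) (vec4 0 (2 * (x $ 1 - M) / Q (x $ 1) (x $ 2))
        (2 * M\<^sup>2 * sin (x $ 2) * cos (x $ 2) / Q (x $ 1) (x $ 2)) 0 \<nu>) x"
    using \<nu> nz chartD(6)[OF assms] unfolding has_partial_def
    by (elim disjE) (auto intro!: derivative_eq_intros)
  show "has_partial \<nu> (\<lambda>x. ln (sin (x $ 2))) (vec4 0 0 (cos (x $ 2) / sin (x $ 2)) 0 \<nu>) x"
    using \<nu> chartD(7)[OF assms] unfolding has_partial_def
    by (elim disjE) (auto intro!: derivative_eq_intros)
qed

lemma has_partial_W:
  assumes "x \<in> chart" shows "has_partial \<nu> (W \<mu>) (p \<mu> \<nu> x) x"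
proof -
  note has_partial_components[OF assms]
  then have "has_partial \<nu> (\<lambda>x. n * ln (C * x $ 0) + cf \<mu> * ln (1 - 2 * M / x $ 1) + cD \<mu> * ln (D (x $ 1))
     + cQ \<mu> * ln (Q (x $ 1) (x $ 2)) + cs \<mu> * ln (sin (x $ 2)))
     ((0 * ln (C * x $ 0) + vec4 (1 / x $ 0) 0 0 0 \<nu> * n)
      + (0 * ln (1 - 2 * M / x $ 1) + vec4 0 (2 * M / D (x $ 1)) 0 0 \<nu> * cf \<mu>)
      + (0 * ln (D (x $ 1)) + vec4 0 (2 * (x $ 1 - M) / D (x $ 1)) 0 0 \<nu> * cD \<mu>)
      + (0 * ln (Q (x $ 1) (x $ 2)) + vec4 0 (2 * (x $ 1 - M) / Q (x $ 1) (x $ 2))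
        (2 * M\<^sup>2 * sin (x $ 2) * cos (x $ 2) / Q (x $ 1) (x $ 2)) 0 \<nu> * cQ \<mu>)
      + (0 * ln (sin (x $ 2)) + vec4 0 0 (cos (x $ 2) / sin (x $ 2)) 0 \<nu> * cs \<mu>)) x"
    by (intro has_partial_add has_partial_mult has_partial_const)
  moreover have "((0 * ln (C * x $ 0) + vec4 (1 / x $ 0) 0 0 0 \<nu> * n)
      + (0 * ln (1 - 2 * M / x $ 1) + vec4 0 (2 * M / D (x $ 1)) 0 0 \<nu> * cf \<mu>)
      + (0 * ln (D (x $ 1)) + vec4 0 (2 * (x $ 1 - M) / D (x $ 1)) 0 0 \<nu> * cD \<mu>)
      + (0 * ln (Q (x $ 1) (x $ 2)) + vec4 0 (2 * (x $ 1 - M) / Q (x $ 1) (x $ 2))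
        (2 * M\<^sup>2 * sin (x $ 2) * cos (x $ 2) / Q (x $ 1) (x $ 2)) 0 \<nu> * cQ \<mu>)
      + (0 * ln (sin (x $ 2)) + vec4 0 0 (cos (x $ 2) / sin (x $ 2)) 0 \<nu> * cs \<mu>)) = p \<mu> \<nu> x"
    using exhaust4[of \<nu>] unfolding p_def Let_def by (elim disjE) (simp_all add: mult.commute)
  ultimately show ?thesis unfolding W_def[abs_def] by simp
qed

lemma has_partial_G:
  assumes "x \<in> chart" shows "has_partial \<nu> (G \<mu>) (2 * p \<mu> \<nu> x * G \<mu> x) x"
proof -
  have "has_partial \<nu> (\<lambda>x. vec4 (-1) 1 1 1 \<mu> * exp (2 * W \<mu> x))
    (0 * exp (2 * W \<mu> x) + exp (2 * W \<mu> x) * (0 * W \<mu> x + p \<mu> \<nu> x * 2) * vec4 (-1) 1 1 1 \<mu>) x"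
    by (intro has_partial_mult has_partial_const has_partial_compose[where F = exp] has_partial_W assms
      DERIV_exp)
  then show ?thesis unfolding G_def[abs_def] by (simp add: algebra_simps)
qed

lemma has_partial_p:
  assumes "x \<in> chart" shows "has_partial \<sigma> (p \<mu> \<nu>) (q \<mu> \<nu> \<sigma> x) x"
proof -
  note [simp] = axis_def neq4 neq4[symmetric]
  note nz = chartD[OF assms] chartD(5,6,7)[OF assms, THEN less_imp_neq, symmetric]
  have 0: "has_partial \<sigma> (p \<mu> 0) (q \<mu> 0 \<sigma> x) x" for \<sigma>
    using nz exhaust4[of \<sigma>] unfolding has_partial_def p_def q_def
    by (elim disjE) (auto intro!: derivative_eq_intros simp: power2_eq_square)
  have 3: "has_partial \<sigma> (p \<mu> 3) (q \<mu> 3 \<sigma> x) x" for \<sigma>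
    unfolding has_partial_def p_def q_def by simp
  have 11: "has_partial 1 (p \<mu> 1) (q \<mu> 1 1 x) x"
    using nz unfolding has_partial_def p_def q_def Let_def
    by (auto intro!: derivative_eq_intros simp: field_simps power2_eq_square)
  have 12: "has_partial 2 (p \<mu> 1) (q \<mu> 1 2 x) x"
    using nz unfolding has_partial_def p_def q_def Let_def
    by (auto intro!: derivative_eq_intros simp: field_simps power2_eq_square)
  have 21: "has_partial 1 (p \<mu> 2) (q \<mu> 2 1 x) x"
    using nz unfolding has_partial_def p_def q_def Let_def
    by (auto intro!: derivative_eq_intros simp: field_simps power2_eq_square)
  \<comment> \<open>This identity holds with sin and cos as independent quantities; the Pythagorean
    rules are removed so that they do not rewrite part of it.\<close>
  have 22: "has_partial 2 (p \<mu> 2) (q \<mu> 2 2 x) x"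
    using nz unfolding has_partial_def p_def q_def Let_def
    by (auto intro!: derivative_eq_intros simp: field_simps power2_eq_square
      simp del: sin_cos_squared_add sin_cos_squared_add2 sin_cos_squared_add3)
  have z: "has_partial 0 (p \<mu> 1) (q \<mu> 1 0 x) x" "has_partial 3 (p \<mu> 1) (q \<mu> 1 3 x) x"
     "has_partial 0 (p \<mu> 2) (q \<mu> 2 0 x) x" "has_partial 3 (p \<mu> 2) (q \<mu> 2 3 x) x"
    unfolding has_partial_def p_def q_def by (simp_all add: Let_def)
  show ?thesis using exhaust4[of \<sigma>] exhaust4[of \<nu>] 0 3 11 12 21 22 z by auto
qed

lemma q_commute: "q \<mu> \<nu> \<sigma> x = q \<mu> \<sigma> \<nu> x"
  using exhaust4[of \<sigma>] exhaust4[of \<nu>] unfolding q_def Let_def by (elim disjE) simp_all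

lemma G_pos: "\<mu> \<noteq> 0 \<Longrightarrow> G \<mu> x > 0" and G_neg: "G 0 x < 0" and G_nonzero: "G \<mu> x \<noteq> 0"
  by (simp_all add: G_def vec4_def)

end

subsection \<open>Curvature of the solution\<close>

text \<open>Agreement is asked only on the chart: elsewhere \<open>powr\<close> and
  \<open>ln\<close> may take default values, and the closed form need not match
  \<open>G\<close>.\<close>

locale zv_metric = zv_cosmology +
  fixes g :: "real ^ 4 \<Rightarrow> real ^ 4 ^ 4"
  assumes metric_eq: "x \<in> chart \<Longrightarrow> g x $ \<mu> $ \<nu> = (if \<mu> = \<nu> then G \<mu> x else 0)"
begin

sublocale diagonal_metric chart g G p q
  by unfold_locales
    (auto simp: open_chart metric_eq G_nonzero has_partial_G has_partial_p intro: q_commute)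

lemma G2_eq:
  assumes "x \<in> chart" shows "G 2 x = D (x $ 1) * G 1 x"
proof -
  have "W 2 x = W 1 x + ln (D (x $ 1)) / 2"
    unfolding W_def cf_def cD_def cQ_def cs_def by (simp add: field_simps)
  then have "2 * W 2 x = ln (D (x $ 1)) + 2 * W 1 x" by simp
  then show ?thesis using chartD(5)[OF assms] by (simp add: G_def exp_add)
qed

lemma pq_values:
  fixes x assumes "x \<in> chart"
  defines "t \<equiv> x $ 0" and "m \<equiv> x $ 1 - M" and "DD \<equiv> D (x $ 1)" and "QQ \<equiv> Q (x $ 1) (x $ 2)"
    and "s \<equiv> sin (x $ 2)" and "c \<equiv> cos (x $ 2)"
  shows "p \<mu> 0 x = n / t" "p \<mu> 3 x = 0"
    "p \<mu> 1 x = cf \<mu> * (2 * M / DD) + cD \<mu> * (2 * m / DD) + cQ \<mu> * (2 * m / QQ)"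
    "p \<mu> 2 x = cQ \<mu> * (2 * M\<^sup>2 * s * c / QQ) + cs \<mu> * (c / s)"
    "q \<mu> 0 0 x = - n / t\<^sup>2" "q \<mu> 0 1 x = 0" "q \<mu> 0 2 x = 0" "q \<mu> 0 3 x = 0"
    "q \<mu> 1 0 x = 0" "q \<mu> 1 3 x = 0" "q \<mu> 2 0 x = 0" "q \<mu> 2 3 x = 0"
    "q \<mu> 3 \<nu> x = 0"
    "q \<mu> 1 1 x = cf \<mu> * (- 4 * M * m / DD\<^sup>2) + cD \<mu> * (2 / DD - 4 * m\<^sup>2 / DD\<^sup>2)
          + cQ \<mu> * (2 / QQ - 4 * m\<^sup>2 / QQ\<^sup>2)"
    "q \<mu> 1 2 x = cQ \<mu> * (- 4 * m * M\<^sup>2 * s * c / QQ\<^sup>2)"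
    "q \<mu> 2 1 x = cQ \<mu> * (- 4 * m * M\<^sup>2 * s * c / QQ\<^sup>2)"
    "q \<mu> 2 2 x = cQ \<mu> * (2 * M\<^sup>2 * (c\<^sup>2 - s\<^sup>2) / QQ - (2 * M\<^sup>2 * s * c)\<^sup>2 / QQ\<^sup>2)
          - cs \<mu> * (1 + (c / s)\<^sup>2)"
  by (simp_all add: p_def q_def Let_def assms)

text \<open>On a solution \<open>w\<close> is \<open>\<kappa> V(\<phi>)\<close>.\<close>

definition w :: "real ^ 4 \<Rightarrow> real" where "w x = (n - 2 * n\<^sup>2) / ((x $ 0)\<^sup>2 * G 0 x)"

text \<open>All \<open>p \<mu> 0 x\<close> equal n / t, so the bracket is (- n + 4 n^2 - 2 n^2) /
  t^2, the 4 counting the summands.\<close>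

lemma time_part:
  assumes "x \<in> chart"
  shows "G \<mu> x / G 0 x * (q \<mu> 0 0 x + p \<mu> 0 x * (\<Sum>m\<in>UNIV. p m 0 x) - 2 * p \<mu> 0 x * p 0 0 x)
    = - G \<mu> x * w x"
  using G_nonzero chartD(2)[OF assms] unfolding pq_values[OF assms] w_def
  by (simp add: field_simps power2_eq_square)

section \<open>Ricci components and wave operator at a point of the chart\<close>

context
  fixes x assumes x: "x \<in> chart"
begin

lemma nonzeros: "D (x $ 1) \<noteq> 0" "Q (x $ 1) (x $ 2) \<noteq> 0" "sin (x $ 2) \<noteq> 0" "x $ 0 \<noteq> 0"
  using chartD[OF x] by auto

text \<open>Once denominators are cleared, the static identities lie in the ideal generated by these
  three relations, which are what \<open>algebra\<close> receives.\<close>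

lemma relations: "D (x $ 1) = (x $ 1 - M)\<^sup>2 - M\<^sup>2"
  "Q (x $ 1) (x $ 2) = D (x $ 1) + M\<^sup>2 * (sin (x $ 2))\<^sup>2"
  "(cos (x $ 2))\<^sup>2 = 1 - (sin (x $ 2))\<^sup>2"
  by (simp_all add: D_def Q_def cos_squared_eq)

lemma ratios: "G 1 x / G 2 x = 1 / D (x $ 1)" "G 2 x / G 1 x = D (x $ 1)"
    "G \<mu> x / G 1 x = D (x $ 1) * (G \<mu> x / G 2 x)"
  using nonzeros G_nonzero by (simp_all add: G2_eq[OF x])

lemma p_01: "p 0 1 x = \<delta> * \<beta> * M / D (x $ 1)"
  by (simp add: pq_values[OF x] coefficients)

text \<open>Since \<open>p l 0 x\<close> is the same for all \<open>l\<close>, the terms with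
  \<open>p l 1 x\<close> cancel, and each of the two remaining directions contributes n / t times
  \<open>p 0 1 x\<close>.\<close>

lemma ricci_01: "ricci g 0 1 x = 2 * (n / x $ 0) * (\<delta> * \<beta> * M / D (x $ 1))"
    and ricci_10: "ricci g 1 0 x = 2 * (n / x $ 0) * (\<delta> * \<beta> * M / D (x $ 1))"
  unfolding p_01[symmetric]
  by (simp_all add: ricci_offdiagonal[OF x] sum4_Diff pq_values(1,6,9)[OF x] algebra_simps)

lemma zero_values: "p 0 2 x = 0" "p 1 2 x = p 2 2 x" "q 0 1 2 x = 0" "q 3 1 2 x = 0" "q 0 2 1 x = 0" "q 3 2 1 x = 0"
   "q 0 2 2 x = 0"
  by (simp_all add: pq_values[OF x] coefficients)

text \<open>The terms with delta beta cancel among themselves. The rest is a multiple of (1 -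
  delta^2) (M^2 sin^2 theta - Q + D), which vanishes by the definition of Q.\<close>

lemma ricci_12_identity: "p 0 1 x * p 2 2 x + p 3 1 x * (p 2 2 x - p 3 2 x) + p 3 2 x * p 2 1 x = 0"
  unfolding pq_values[OF x] coefficients
  using nonzeros
  by (simp add: divide_simps) (use relations in algebra)

lemma ricci_12: "ricci g 1 2 x = 0" and ricci_21: "ricci g 2 1 x = 0"
  using ricci_12_identity
  by (simp_all add: ricci_offdiagonal[OF x] sum4_Diff zero_values algebra_simps)

lemma ricci_zero: "ricci g 0 2 x = 0" "ricci g 2 0 x = 0" "ricci g 0 3 x = 0"
    "ricci g 3 0 x = 0" "ricci g 1 3 x = 0" "ricci g 3 1 x = 0"
    "ricci g 2 3 x = 0" "ricci g 3 2 x = 0"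
  by (simp_all add: ricci_offdiagonal[OF x] sum4_Diff pq_values[OF x] coefficients algebra_simps)

lemma ricci_00: "ricci g 0 0 x = 3 * n / (x $ 0)\<^sup>2"
proof -
  \<comment> \<open>This is the harmonicity of ln f in the static geometry: \<open>p 0 1\<close> is
    a multiple of 1 / D, and the sum minus twice \<open>p 1 1\<close> is 2 (r - M) / D, the
    logarithmic derivative of D.\<close>
  have "q 0 1 1 x + p 0 1 x * (\<Sum>m\<in>UNIV. p m 1 x) - 2 * p 0 1 x * p 1 1 x = 0"
    using nonzeros by (simp add: sum4 pq_values[OF x] coefficients field_simps power2_eq_square)
  moreover have "q 0 2 2 x = 0" "p 0 2 x = 0" "q 0 3 3 x = 0" "p 0 3 x = 0"
    by (simp_all add: pq_values[OF x] coefficients)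
  ultimately show ?thesis
    by (simp add: ricci_diagonal[OF x] sum4_Diff pq_values(1,5)[OF x])
qed

text \<open>For beta^2 = 1 the static term would vanish, as for the vacuum Zipoy-Voorhees metric.
  The deficit delta^2 (1 - beta^2) is what the radial gradient of the scalar field has to
  supply.\<close>

lemma ricci_11: "ricci g 1 1 x = 2 * (\<delta>\<^sup>2 - (\<delta> * \<beta>)\<^sup>2) * M\<^sup>2 / (D (x $ 1))\<^sup>2 + G 1 x * w x"
proof -
  have "p 0 1 x * (p 1 1 x - p 0 1 x) - q 0 1 1 x + p 2 1 x * (p 1 1 x - p 2 1 x) - q 2 1 1 x
    + p 3 1 x * (p 1 1 x - p 3 1 x) - q 3 1 1 x
    - 1 / D (x $ 1) * (q 1 2 2 x + p 1 2 x * (\<Sum>m\<in>UNIV. p m 2 x) - 2 * p 1 2 x * p 2 2 x)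
    = 2 * (\<delta>\<^sup>2 - (\<delta> * \<beta>)\<^sup>2) * M\<^sup>2 / (D (x $ 1))\<^sup>2"
    using nonzeros
    by (simp add: sum4 pq_values[OF x] coefficients power_mult_distrib relations(3) divide_simps)
      (use relations in algebra)
  then show ?thesis
    unfolding ricci_diagonal[OF x] sum4_Diff ratios(1) time_part[OF x]
    by (simp add: pq_values(2,13)[OF x])
qed

lemma ricci_22: "ricci g 2 2 x = G 2 x * w x"
proof -
  have "p 0 2 x * (p 2 2 x - p 0 2 x) - q 0 2 2 x + p 1 2 x * (p 2 2 x - p 1 2 x) - q 1 2 2 x
    + p 3 2 x * (p 2 2 x - p 3 2 x) - q 3 2 2 x
    - D (x $ 1) * (q 2 1 1 x + p 2 1 x * (\<Sum>m\<in>UNIV. p m 1 x) - 2 * p 2 1 x * p 1 1 x) = 0"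
    using nonzeros
    by (simp add: sum4 pq_values[OF x] coefficients power_mult_distrib relations(3) divide_simps)
      (use relations in algebra)
  then show ?thesis
    unfolding ricci_diagonal[OF x] sum4_Diff ratios(2) time_part[OF x]
    by (simp add: pq_values(2,13)[OF x])
qed

lemma ricci_33: "ricci g 3 3 x = G 3 x * w x"
proof -
  have "D (x $ 1) * (q 3 1 1 x + p 3 1 x * (\<Sum>m\<in>UNIV. p m 1 x) - 2 * p 3 1 x * p 1 1 x)
    + (q 3 2 2 x + p 3 2 x * (\<Sum>m\<in>UNIV. p m 2 x) - 2 * p 3 2 x * p 2 2 x) = 0"
    using nonzeros
    by (simp add: sum4 pq_values[OF x] coefficients divide_simps)
      (use relations in algebra)
  \<comment> \<open>The real powers are hidden in \<rho>, a common factor of both static terms, so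
    \<open>algebra\<close> sees it as a free symbol.\<close>
  moreover define \<rho> where "\<rho> = G 3 x / G 2 x"
  moreover have "G 3 x / G 1 x = D (x $ 1) * \<rho>"
    unfolding \<rho>_def by (rule ratios(3))
  ultimately show ?thesis
    unfolding ricci_diagonal[OF x] sum4_Diff time_part[OF x] pq_values(2,13)[OF x] by algebra
qed

text \<open>The partials are those of k ln |t| + j ln f. The second summand is harmonic, as in
  \<open>ricci_00\<close>, so only time derivatives survive. The hypotheses concern the whole chart
  because second partials need a neighbourhood.\<close>

lemma box_metric:
  assumes "\<And>x. x \<in> chart \<Longrightarrow> partial 0 \<phi> x = k / x $ 0"
    "\<And>x. x \<in> chart \<Longrightarrow> partial 1 \<phi> x = j * (2 * M / D (x $ 1))"
    "\<And>x. x \<in> chart \<Longrightarrow> partial 2 \<phi> x = 0" "\<And>x. x \<in> chart \<Longrightarrow> partial 3 \<phi> x = 0"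
  shows "dalembertian g \<phi> x = k * (2 * n - 1) / ((x $ 0)\<^sup>2 * G 0 x)"
proof -
  note [simp] = nonzeros axis_def neq4 neq4[symmetric]
  have "has_partial 0 (\<lambda>x. k / x $ 0) (- k / (x $ 0)\<^sup>2) x"
    unfolding has_partial_def by (auto intro!: derivative_eq_intros simp: power2_eq_square)
  moreover have "partial 0 (partial 0 \<phi>) x = partial 0 (\<lambda>x. k / x $ 0) x"
    by (rule partial_cong[OF open_chart x assms(1)])
  ultimately have 0: "partial 0 (partial 0 \<phi>) x = - k / (x $ 0)\<^sup>2"
    by (simp add: partial_eq)
  have "has_partial 1 (\<lambda>x. j * (2 * M / D (x $ 1))) (- j * 4 * M * (x $ 1 - M) / (D (x $ 1))\<^sup>2) x"
    unfolding has_partial_def by (auto intro!: derivative_eq_intros simp: power2_eq_square)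
  moreover have "partial 1 (partial 1 \<phi>) x = partial 1 (\<lambda>x. j * (2 * M / D (x $ 1))) x"
    by (rule partial_cong[OF open_chart x assms(2)])
  ultimately have 1: "partial 1 (partial 1 \<phi>) x = - j * 4 * M * (x $ 1 - M) / (D (x $ 1))\<^sup>2"
    by (simp add: partial_eq)
  have 2: "partial 2 (partial 2 \<phi>) x = 0" "partial 3 (partial 3 \<phi>) x = 0"
    using partial_cong[of chart x "partial 2 \<phi>" "\<lambda>x. 0", OF open_chart x assms(3)]
      partial_cong[of chart x "partial 3 \<phi>" "\<lambda>x. 0", OF open_chart x assms(4)]
    by (simp_all add: partial_eq[OF has_partial_const])
  have "p 0 1 x + p 1 1 x + p 2 1 x + p 3 1 x - 2 * p 1 1 x = 2 * (x $ 1 - M) / D (x $ 1)"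
    by (simp add: pq_values[OF x] coefficients field_simps)
  then have "partial 1 (partial 1 \<phi>) x + partial 1 \<phi> x * ((\<Sum>\<nu>\<in>UNIV. p \<nu> 1 x) - 2 * p 1 1 x) = 0"
    unfolding sum4 by (simp add: 1 assms(2)[OF x] power2_eq_square)
  then have "dalembertian g \<phi> x = (- k / (x $ 0)\<^sup>2 + k / x $ 0 * (2 * n / x $ 0)) / G 0 x"
    unfolding dalembertian_eq[OF x] sum4[of "\<lambda>\<mu>. _ \<mu> / G \<mu> x"]
    by (simp add: 0 2 assms x pq_values(1)[OF x])
  also have "\<dots> = k * (2 * n - 1) / ((x $ 0)\<^sup>2 * G 0 x)"
    using G_nonzero by (simp add: field_simps power2_eq_square)
  finally show ?thesis .
qed

end
end

subsection \<open>The closed form and its coupling constants\<close>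

text \<open>With every positive factor written as an exponential, only exponents have to be
  compared. Here \<open>b\<close> and \<open>d\<close> stand for delta beta and delta^2, and
  \<open>2 * ln r + ln F\<close> and \<open>2 * ln r + ln G\<close> are ln D and ln Q.\<close>

lemma exp_form:
  fixes T F G r s n d b :: real
  assumes "T > 0" "F > 0" "G > 0" "r > 0" "s > 0"
  shows "(T powr n)\<^sup>2 * (F powr b) = exp (2 * (n * ln T + b / 2 * ln F))"
    and "(T powr n)\<^sup>2 * (F powr (- b) * ((F / G) powr d * G * (1 / F))) =
      exp (2 * (n * ln T + - (b / 2) * ln F + (d - 1) / 2 * (2 * ln r + ln F)
        + (1 - d) / 2 * (2 * ln r + ln G)))"
    and "(T powr n)\<^sup>2 * (F powr (- b) * ((F / G) powr d * G * r\<^sup>2)) =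
      exp (2 * (n * ln T + - (b / 2) * ln F + d / 2 * (2 * ln r + ln F)
        + (1 - d) / 2 * (2 * ln r + ln G)))"
    and "(T powr n)\<^sup>2 * (F powr (- b) * (F * r\<^sup>2 * s\<^sup>2)) =
      exp (2 * (n * ln T + - (b / 2) * ln F + 1 / 2 * (2 * ln r + ln F) + ln s))"
proof -
  obtain t f g \<rho> \<sigma> where [simp]: "T = exp t" "F = exp f" "G = exp g" "r = exp \<rho>" "s = exp \<sigma>"
    using assms by (metis exp_ln)
  note [simp] = exp_powr_real exp_diff[symmetric] mult_exp_exp power2_eq_square
  have [simp]: "1 / exp f = exp (- f)" by (simp add: exp_minus inverse_eq_divide)
  show "(T powr n)\<^sup>2 * (F powr b) = exp (2 * (n * ln T + b / 2 * ln F))"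
    by (simp add: algebra_simps)
  show "(T powr n)\<^sup>2 * (F powr (- b) * ((F / G) powr d * G * (1 / F))) =
      exp (2 * (n * ln T + - (b / 2) * ln F + (d - 1) / 2 * (2 * ln r + ln F)
        + (1 - d) / 2 * (2 * ln r + ln G)))"
    by (simp add: field_simps)
  show "(T powr n)\<^sup>2 * (F powr (- b) * ((F / G) powr d * G * r\<^sup>2)) =
      exp (2 * (n * ln T + - (b / 2) * ln F + d / 2 * (2 * ln r + ln F)
        + (1 - d) / 2 * (2 * ln r + ln G)))"
    by (simp add: field_simps)
  show "(T powr n)\<^sup>2 * (F powr (- b) * (F * r\<^sup>2 * s\<^sup>2)) =
      exp (2 * (n * ln T + - (b / 2) * ln F + 1 / 2 * (2 * ln r + ln F) + ln s))"
    by (simp add: field_simps)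
qed

section \<open>Agreement with the stated metric, and smoothness\<close>

context zv_cosmology begin

lemma G_closed_form:
  assumes "x \<in> chart"
  defines "r \<equiv> x $ 1" and "\<theta> \<equiv> x $ 2" and "A \<equiv> ((C * x $ 0) powr n)\<^sup>2"
  defines "F \<equiv> 1 - 2 * M / r"
  defines "H \<equiv> F + M\<^sup>2 * (sin \<theta>)\<^sup>2 / r\<^sup>2"
  shows "G 0 x = A * - (F powr (\<delta> * \<beta>))"
    "G 1 x = A * (F powr (- (\<delta> * \<beta>)) * ((F / H) powr \<delta>\<^sup>2 * H * (1 / F)))"
    "G 2 x = A * (F powr (- (\<delta> * \<beta>)) * ((F / H) powr \<delta>\<^sup>2 * H * r\<^sup>2))"
    "G 3 x = A * (F powr (- (\<delta> * \<beta>)) * (F * r\<^sup>2 * (sin \<theta>)\<^sup>2))"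
proof -
  have r: "r > 0" and F: "F > 0" and T: "C * x $ 0 > 0" and s: "sin \<theta> > 0"
    using chartD[OF assms(1)] unfolding F_def r_def \<theta>_def by auto
  then have H: "H > 0" unfolding H_def by (simp add: add_pos_nonneg)
  have "D r = r\<^sup>2 * F" "Q r \<theta> = r\<^sup>2 * H"
    using r unfolding D_def Q_def F_def H_def by (simp_all add: field_simps power2_eq_square)
  then have D: "ln (D r) = 2 * ln r + ln F" and Q: "ln (Q r \<theta>) = 2 * ln r + ln H"
    using r F H by (simp_all add: ln_mult ln_realpow)
  note e1 = exp_form(1)[OF T F H r s, of n "\<delta> * \<beta>", folded A_def]
  note e = exp_form(2-4)[OF T F H r s, where b = "\<delta> * \<beta>" and n = n, folded A_def]
  note W = G_def W_def r_def[symmetric] \<theta>_def[symmetric] F_def[symmetric] D Q coefficients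
  show "G 0 x = A * - (F powr (\<delta> * \<beta>))"
    unfolding mult_minus_right e1 W by simp
  show "G 1 x = A * (F powr (- (\<delta> * \<beta>)) * ((F / H) powr \<delta>\<^sup>2 * H * (1 / F)))"
    unfolding e(1) W by simp
  show "G 2 x = A * (F powr (- (\<delta> * \<beta>)) * ((F / H) powr \<delta>\<^sup>2 * H * r\<^sup>2))"
    unfolding e(2) W by simp
  show "G 3 x = A * (F powr (- (\<delta> * \<beta>)) * (F * r\<^sup>2 * (sin \<theta>)\<^sup>2))"
    unfolding e(3) W by simp
qed

lemma smooth_components:
  "smooth_on chart (\<lambda>x. ln (C * x $ 0))" "smooth_on chart (\<lambda>x. ln (1 - 2 * M / x $ 1))"
  "smooth_on chart (\<lambda>x. ln (D (x $ 1)))" "smooth_on chart (\<lambda>x. ln (Q (x $ 1) (x $ 2)))"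
  "smooth_on chart (\<lambda>x. ln (sin (x $ 2)))"
proof -
  note rules = smooth_on_ln smooth_on_add smooth_on_mult smooth_on_sin smooth_on_const
    smooth_on_coord open_chart
  show "smooth_on chart (\<lambda>x. ln (C * x $ 0))" "smooth_on chart (\<lambda>x. ln (sin (x $ 2)))"
    by (intro rules chartD; assumption)+
  have D: "D r = (r + (- M)) * (r + (- M)) + (- (M * M))" for r
    by (simp add: D_def power2_eq_square)
  have Q: "Q r \<theta> = D r + M * M * (sin \<theta> * sin \<theta>)" for r \<theta>
    by (simp add: Q_def power2_eq_square)
  have sD: "smooth_on chart (\<lambda>x. D (x $ 1))" unfolding D by (intro rules)
  then show lnD: "smooth_on chart (\<lambda>x. ln (D (x $ 1)))"
    by (intro smooth_on_ln open_chart chartD)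
  have "smooth_on chart (\<lambda>x. Q (x $ 1) (x $ 2))" unfolding Q by (intro rules sD)
  then show "smooth_on chart (\<lambda>x. ln (Q (x $ 1) (x $ 2)))"
    by (intro smooth_on_ln open_chart chartD)
  \<comment> \<open>Writing ln f as ln D - 2 ln r reduces the quotient to functions covered by the
    smoothness rules.\<close>
  have "ln (1 - 2 * M / x $ 1) = ln (D (x $ 1)) + (-2) * ln (x $ 1)" if "x \<in> chart" for x
  proof -
    have "x $ 1 > 0" using chartD[OF that] by simp
    then show ?thesis using chartD(5)[OF that] D_eq[of "x $ 1"] by (simp add: ln_div ln_realpow)
  qed
  moreover have "smooth_on chart (\<lambda>x. ln (D (x $ 1)) + (-2) * ln (x $ 1))"
    by (intro rules lnD chartD)
  ultimately show "smooth_on chart (\<lambda>x. ln (1 - 2 * M / x $ 1))"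
    using smooth_on_cong[OF open_chart, of "\<lambda>x. ln (1 - 2 * M / x $ 1)"
        "\<lambda>x. ln (D (x $ 1)) + (-2) * ln (x $ 1)"] by blast
qed

lemma smooth_G: "smooth_on chart (G \<mu>)"
  unfolding G_def[abs_def] W_def
  by (intro smooth_on_add smooth_on_mult smooth_on_exp smooth_on_const open_chart smooth_components)

end

context zv_metric begin

lemma lorentzian: "lorentzian_metric_on chart g"
  unfolding lorentzian_metric_on_def
proof (intro conjI allI ballI)
  fix \<mu> \<nu>
  have "smooth_on chart (\<lambda>x. g x $ \<mu> $ \<nu>) \<longleftrightarrow> smooth_on chart (\<lambda>x. if \<mu> = \<nu> then G \<mu> x else 0)"
    by (rule smooth_on_cong[OF open_chart]) (rule metric_eq)
  then show "smooth_on chart (\<lambda>x. g x $ \<mu> $ \<nu>)"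
    using smooth_G smooth_on_const by (cases "\<mu> = \<nu>") simp_all
next
  fix x assume x: "x \<in> chart"
  show "transpose (g x) = g x"
    by (simp add: transpose_def vec_eq_iff metric_eq[OF x])
  show "\<exists>P. invertible P \<and> transpose P ** g x ** P = diag4 (- 1) 1 1 1"
    by (rule lorentzian_diag4[of "\<lambda>i. G i x"]) (simp_all add: metric_eq[OF x] G_neg G_pos)
qed

end

text \<open>The first relation matches R_01 and the power of f in V, the second matches R_11, the
  third matches R_00 and the power of t in V, and the fourth matches the amplitude of V.\<close>

lemma coupling_constants:
  fixes \<kappa> \<beta> \<xi>\<^sub>0 \<xi>\<^sub>1 n C V\<^sub>0 :: real
  assumes "\<kappa> > 0" "-1 < \<beta>" "\<beta> < 1" "\<beta>\<^sup>2 \<noteq> 1 / 2"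
    and "\<xi>\<^sub>0 = sqrt ((1 - \<beta>\<^sup>2) / (2 * \<kappa>))" "\<xi>\<^sub>1 = \<beta> / \<xi>\<^sub>0"
    and "n = 2 * \<xi>\<^sub>0\<^sup>2 * \<kappa> / (\<beta>\<^sup>2 - 2 * \<xi>\<^sub>0\<^sup>2 * \<kappa>)"
    and "V\<^sub>0 = - (2 * \<xi>\<^sub>0\<^sup>2 * C\<^sup>2 * (\<beta>\<^sup>2 - 6 * \<xi>\<^sub>0\<^sup>2 * \<kappa>) / (2 * \<xi>\<^sub>0\<^sup>2 * \<kappa> - \<beta>\<^sup>2)\<^sup>2)"
  shows "\<xi>\<^sub>1 * \<xi>\<^sub>0 = \<beta>" "2 * \<kappa> * \<xi>\<^sub>0\<^sup>2 = 1 - \<beta>\<^sup>2" "\<xi>\<^sub>1\<^sup>2 * n / \<kappa> = 2 * n + 2"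
    "\<kappa> * V\<^sub>0 = (2 * n\<^sup>2 - n) * C\<^sup>2"
proof -
  have "\<beta>\<^sup>2 < 1" using assms(2,3) by (simp add: abs_square_less_1 abs_less_iff)
  then have pos: "(1 - \<beta>\<^sup>2) / (2 * \<kappa>) > 0" using assms(1) by simp
  then have x0: "\<xi>\<^sub>0 > 0" using assms(5) by simp
  then show "\<xi>\<^sub>1 * \<xi>\<^sub>0 = \<beta>" using assms(6) by simp
  have "\<xi>\<^sub>0\<^sup>2 = (1 - \<beta>\<^sup>2) / (2 * \<kappa>)" using pos assms(5) by simp
  then show k: "2 * \<kappa> * \<xi>\<^sub>0\<^sup>2 = 1 - \<beta>\<^sup>2" using assms(1) by simp
  \<comment> \<open>\<open>b\<close> equals the denominator of \<open>n\<close>, and it is nonzero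
    by the hypothesis on \<open>\<beta>\<close>. In terms of it all constants become rational
    functions of one variable.\<close>
  define b where "b = 2 * \<beta>\<^sup>2 - 1"
  have b: "b \<noteq> 0" using assms(4) by (simp add: b_def)
  have B: "\<beta>\<^sup>2 = (b + 1) / 2" by (simp add: b_def)
  have k': "\<xi>\<^sub>0\<^sup>2 * \<kappa> = (1 - b) / 4" using k unfolding B by (simp add: field_simps)
  have n: "n = (1 - b) / (2 * b)" unfolding assms(7) mult.assoc k' B using b by (simp add: field_simps)
  have "\<xi>\<^sub>1\<^sup>2 * n / \<kappa> = \<beta>\<^sup>2 * n / (\<xi>\<^sub>0\<^sup>2 * \<kappa>)" unfolding assms(6) by (simp add: field_simps)
  also have "\<dots> = 2 * n + 2"
  proof -
    have "1 - b \<noteq> 0" using \<open>\<beta>\<^sup>2 < 1\<close> by (simp add: b_def)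
    then show ?thesis unfolding k' B n using b by (simp add: field_simps)
  qed
  finally show "\<xi>\<^sub>1\<^sup>2 * n / \<kappa> = 2 * n + 2" .
  have "\<kappa> * V\<^sub>0 = - (2 * (\<xi>\<^sub>0\<^sup>2 * \<kappa>) * C\<^sup>2 * (\<beta>\<^sup>2 - 6 * (\<xi>\<^sub>0\<^sup>2 * \<kappa>)) / (2 * (\<xi>\<^sub>0\<^sup>2 * \<kappa>) - \<beta>\<^sup>2)\<^sup>2)"
    unfolding assms(8) by (simp add: algebra_simps)
  also have "\<dots> = (2 * n\<^sup>2 - n) * C\<^sup>2"
    unfolding k' B n using b by (simp add: field_simps power2_eq_square)
  finally show "\<kappa> * V\<^sub>0 = (2 * n\<^sup>2 - n) * C\<^sup>2" .
qed

theorem mainTheorem2: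
  fixes \<kappa> M \<delta> C \<beta> \<xi>\<^sub>0 \<xi>\<^sub>1 \<xi>\<^sub>2 \<xi>\<^sub>3 V\<^sub>0 :: real
    and f a V :: "real \<Rightarrow> real" and g :: "real \<Rightarrow> real \<Rightarrow> real"
    and U :: "(real ^ 4) set"
    and metric :: "real ^ 4 \<Rightarrow> real ^ 4 ^ 4" and \<phi> :: "real ^ 4 \<Rightarrow> real"
  assumes "\<kappa> > 0" and "M > 0" and "\<delta> > 0" and "C \<noteq> 0"
    and "-1 < \<beta>" and "\<beta> < 1" and "\<beta>\<^sup>2 \<noteq> 1 / 2"
    and "\<xi>\<^sub>0 = sqrt ((1 - \<beta>\<^sup>2) / (2 * \<kappa>))"
    and "\<xi>\<^sub>1 = \<beta> / \<xi>\<^sub>0" and "\<xi>\<^sub>3 = - \<xi>\<^sub>1"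
    and "\<xi>\<^sub>2 = 2 * \<xi>\<^sub>0\<^sup>2 * \<kappa> / (\<beta>\<^sup>2 - 2 * \<xi>\<^sub>0\<^sup>2 * \<kappa>)"
    and "V\<^sub>0 = - (2 * \<xi>\<^sub>0\<^sup>2 * C\<^sup>2 * (\<beta>\<^sup>2 - 6 * \<xi>\<^sub>0\<^sup>2 * \<kappa>) / (2 * \<xi>\<^sub>0\<^sup>2 * \<kappa> - \<beta>\<^sup>2)\<^sup>2)"
    and "f = (\<lambda>r. 1 - 2 * M / r)"
    and "g = (\<lambda>r \<theta>. 1 - 2 * M / r + M\<^sup>2 * (sin \<theta>)\<^sup>2 / r\<^sup>2)"
    and "a = (\<lambda>t. (C * t) powr \<xi>\<^sub>2)"
    and "U = {x. (if C > 0 then 0 < x $ 0 else x $ 0 < 0) \<and>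
                 2 * M < x $ 1 \<and> 0 < x $ 2 \<and> x $ 2 < pi}"
    and "metric = (\<lambda>x. let t = x $ 0; r = x $ 1; \<theta> = x $ 2;
             F = f r; G = g r \<theta>
           in (a t)\<^sup>2 *\<^sub>R diag4
                (- (F powr (\<delta> * \<beta>)))
                (F powr (- (\<delta> * \<beta>)) * ((F / G) powr \<delta>\<^sup>2 * G * (1 / F)))
                (F powr (- (\<delta> * \<beta>)) * ((F / G) powr \<delta>\<^sup>2 * G * r\<^sup>2))
                (F powr (- (\<delta> * \<beta>)) * (F * r\<^sup>2 * (sin \<theta>)\<^sup>2)))"
    and "\<phi> = (\<lambda>x. \<delta> * \<xi>\<^sub>0 * ln (1 - 2 * M / x $ 1) + \<xi>\<^sub>1 * \<xi>\<^sub>2 / \<kappa> * ln (C * x $ 0))"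
    and "V = (\<lambda>s. V\<^sub>0 * exp (\<xi>\<^sub>3 * s))"
  shows "einstein_scalar_solution \<kappa> V U metric \<phi>"
proof -
  note H = assms
  interpret zv_cosmology M \<delta> C \<beta> \<xi>\<^sub>2
    using H(2,4) by unfold_locales
  have U: "U = chart"
    unfolding H(16) chart_def using H(4) by (auto simp: zero_less_mult_iff)
  have metric: "metric x $ \<mu> $ \<nu> = (if \<mu> = \<nu> then G \<mu> x else 0)" if "x \<in> chart" for x \<mu> \<nu>
    using exhaust4[of \<mu>]
    by (elim disjE) (simp_all add: H(13-15,17) Let_def diag4_def G_closed_form[OF that] neq4 neq4[symmetric])
  interpret zv_metric M \<delta> C \<beta> \<xi>\<^sub>2 metric
    by unfold_locales (rule metric)
  note const = coupling_constants[OF H(1,5-7,8,9,11,12)]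

  have \<phi>': "has_partial \<nu> \<phi> (vec4 (\<xi>\<^sub>1 * \<xi>\<^sub>2 / \<kappa> / x $ 0) (\<delta> * \<xi>\<^sub>0 * (2 * M / D (x $ 1))) 0 0 \<nu>) x"
    if "x \<in> chart" for x \<nu>
  proof -
    have "has_partial \<nu> \<phi>
      ((0 * ln (1 - 2 * M / x $ 1) + vec4 0 (2 * M / D (x $ 1)) 0 0 \<nu> * (\<delta> * \<xi>\<^sub>0))
        + (0 * ln (C * x $ 0) + vec4 (1 / x $ 0) 0 0 0 \<nu> * (\<xi>\<^sub>1 * \<xi>\<^sub>2 / \<kappa>))) x"
      unfolding H(18)
      by (intro has_partial_add has_partial_mult has_partial_const has_partial_components that)
    then show ?thesis
      using exhaust4[of \<nu>] by (elim disjE) (simp_all add: mult.commute)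
  qed
  note d\<phi> = partial_eq[OF \<phi>']

  have V: "\<kappa> * V (\<phi> x) = w x" if "x \<in> chart" for x
  proof -
    define F where "F = ln (1 - 2 * M / x $ 1)"
    define T where "T = ln (C * x $ 0)"
    have "\<xi>\<^sub>3 * \<phi> x = - (\<xi>\<^sub>1 * \<xi>\<^sub>0) * \<delta> * F - \<xi>\<^sub>1\<^sup>2 * \<xi>\<^sub>2 / \<kappa> * T"
      unfolding H(10,18) F_def T_def by (simp add: algebra_simps power2_eq_square)
    \<comment> \<open>The exponential of the bracket is |G_0|, and the leftover
      \<open>- 2 * T\<close> supplies the factor 1 / (C t)^2.\<close>
    also have "\<dots> = - (2 * (\<xi>\<^sub>2 * T + \<delta> * \<beta> / 2 * F)) - 2 * T"
      unfolding const(1,3) by (simp add: algebra_simps)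
    also have "exp \<dots> = 1 / exp (2 * (\<xi>\<^sub>2 * T + \<delta> * \<beta> / 2 * F)) / exp T ^ 2"
      by (simp only: exp_diff exp_minus inverse_eq_divide exp_double[of T])
    also have "\<dots> = - 1 / G 0 x / (C * x $ 0)\<^sup>2"
      using chartD(1)[OF that] by (simp add: G_def W_def coefficients F_def T_def)
    finally have "\<kappa> * V (\<phi> x) = \<kappa> * V\<^sub>0 * (- 1 / G 0 x / (C * x $ 0)\<^sup>2)"
      unfolding H(19) by simp
    also have "\<dots> = w x"
      unfolding const(4) w_def using C_nz chartD(2)[OF that] G_nonzero[of 0 x]
      by (simp add: field_simps power2_eq_square)
    finally show ?thesis .
  qed

  have ricci: "ricci metric \<mu> \<nu> x = \<kappa> * (partial \<mu> \<phi> x * partial \<nu> \<phi> x + metric x $ \<mu> $ \<nu> * V (\<phi> x))"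
    if x: "x \<in> chart" for \<mu> \<nu> x
  proof -
    note nz = nonzeros[OF x]
    \<comment> \<open>With n for \<open>\<xi>\<^sub>2\<close> this amounts to 3 n = (2 n + 2) n + (n
      - 2 n^2).\<close>
    have tt: "3 * \<xi>\<^sub>2 / (x $ 0)\<^sup>2 = \<kappa> * (\<xi>\<^sub>1 * \<xi>\<^sub>2 / \<kappa> / x $ 0)\<^sup>2 + G 0 x * w x"
    proof -
      have "\<kappa> * (\<xi>\<^sub>1 * \<xi>\<^sub>2 / \<kappa> / x $ 0)\<^sup>2 = \<xi>\<^sub>1\<^sup>2 * \<xi>\<^sub>2 / \<kappa> * \<xi>\<^sub>2 / (x $ 0)\<^sup>2"
        using H(1) by (simp add: field_simps power2_eq_square)
      also have "\<dots> = (2 * \<xi>\<^sub>2 + 2) * \<xi>\<^sub>2 / (x $ 0)\<^sup>2" unfolding const(3) ..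
      finally have phi_t: "\<kappa> * (\<xi>\<^sub>1 * \<xi>\<^sub>2 / \<kappa> / x $ 0)\<^sup>2 = (2 * \<xi>\<^sub>2 + 2) * \<xi>\<^sub>2 / (x $ 0)\<^sup>2" .
      show ?thesis
        unfolding phi_t w_def using nz G_nonzero[of 0 x]
        by (simp add: field_simps power2_eq_square)
    qed
    have tr: "2 * (\<xi>\<^sub>2 / x $ 0) * (\<delta> * \<beta> * M / D (x $ 1)) =
      \<kappa> * ((\<xi>\<^sub>1 * \<xi>\<^sub>2 / \<kappa> / x $ 0) * (\<delta> * \<xi>\<^sub>0 * (2 * M / D (x $ 1))))"
      unfolding const(1)[symmetric] using H(1) by (simp add: field_simps)
    have rr: "2 * (\<delta>\<^sup>2 - (\<delta> * \<beta>)\<^sup>2) * M\<^sup>2 / (D (x $ 1))\<^sup>2 = \<kappa> * (\<delta> * \<xi>\<^sub>0 * (2 * M / D (x $ 1)))\<^sup>2"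
    proof -
      have "\<kappa> * (\<delta> * \<xi>\<^sub>0 * (2 * M / D (x $ 1)))\<^sup>2 = 2 * (2 * \<kappa> * \<xi>\<^sub>0\<^sup>2) * \<delta>\<^sup>2 * M\<^sup>2 / (D (x $ 1))\<^sup>2"
        by (simp add: power2_eq_square)
      then show ?thesis
        unfolding const(2) by (simp add: power_mult_distrib algebra_simps)
    qed
    define P where "P = \<xi>\<^sub>1 * \<xi>\<^sub>2 / \<kappa> / x $ 0"
    define R where "R = \<delta> * \<xi>\<^sub>0 * (2 * M / D (x $ 1))"
    have "ricci metric 0 0 x = \<kappa> * P\<^sup>2 + G 0 x * w x"
        "ricci metric 0 1 x = \<kappa> * (P * R)" "ricci metric 1 0 x = \<kappa> * (P * R)"
        "ricci metric 1 1 x = \<kappa> * R\<^sup>2 + G 1 x * w x"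
      unfolding ricci_00[OF x] ricci_01[OF x] ricci_10[OF x] ricci_11[OF x] tt tr rr P_def R_def
      by (rule refl)+
    moreover have "partial \<alpha> \<phi> x = vec4 P R 0 0 \<alpha>" for \<alpha>
      unfolding d\<phi>[OF x] P_def R_def ..
    ultimately show ?thesis
      unfolding metric[OF x] V[OF x, symmetric]
      using exhaust4[of \<mu>] exhaust4[of \<nu>]
      by (elim disjE)
        (simp_all add: ricci_12[OF x] ricci_21[OF x] ricci_22[OF x] ricci_33[OF x] ricci_zero[OF x]
          V[OF x, symmetric] neq4 neq4[symmetric] power2_eq_square algebra_simps)
  qed

  have V': "(V has_real_derivative \<xi>\<^sub>3 * V s) (at s)" for s
    unfolding H(19) by (auto intro!: derivative_eq_intros)
  have box: "dalembertian metric \<phi> x = deriv V (\<phi> x)" if x: "x \<in> chart" for x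
  proof -
    have "dalembertian metric \<phi> x = \<xi>\<^sub>1 * \<xi>\<^sub>2 / \<kappa> * (2 * \<xi>\<^sub>2 - 1) / ((x $ 0)\<^sup>2 * G 0 x)"
      by (rule box_metric[OF x, of _ _ "\<delta> * \<xi>\<^sub>0"]) (simp_all add: d\<phi>)
    \<comment> \<open>The factor n (2 n - 1) of the wave operator is minus the factor n - 2 n^2 of
      \<open>w\<close>, with n for \<open>\<xi>\<^sub>2\<close>.\<close>
    also have "\<dots> = - \<xi>\<^sub>1 * (w x / \<kappa>)"
      unfolding w_def by (simp add: power2_eq_square algebra_simps diff_divide_distrib)
    also have "w x / \<kappa> = V (\<phi> x)"
      using V[OF x] H(1) by (simp add: field_simps)
    also have "- \<xi>\<^sub>1 * V (\<phi> x) = deriv V (\<phi> x)"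
      using DERIV_imp_deriv[OF V'] H(10) by simp
    finally show ?thesis .
  qed

  have "smooth_on chart \<phi>"
    unfolding H(18)
    by (intro smooth_on_add smooth_on_mult smooth_on_const open_chart smooth_components)
  moreover have "V field_differentiable (at s)" for s
    using V' field_differentiable_def by blast
  ultimately show ?thesis
    unfolding einstein_scalar_solution_def U
    using open_chart lorentzian box einstein_tensor_eqI[OF _ ricci] by blast
qed

end
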